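(* Let $\{\lambda(X_v)^{-1}T_v\}_{v\in\mathbb{T}}$ be a doubly stochastic Yule (DSY) cascade of type $(\mathcal{M})$ with state space $(S,\mathcal{S})$ and one-step transition probability $p(x,dy)$, such that along each path $s\in\partial\mathbb{T}$ the Markov process $X_{s|0},X_{s|1},X_{s|2},\dots$ is time-reversible with respect to an invariant probability measure $\gamma$. For $a>0$ let $T_a:L^2(\gamma)\to L^2(\gamma)$ be the operator $$T_af(x)=\frac{\lambda(x)}{a+\lambda(x)}\int_S f(y)\,p(x,dy).$$ If, for some $a>0$, the spectral radius of $T_a:L^2(\gamma)\to L^2(\gamma)$ or its operator norm is strictly less than $1/2$, then: (a) for $\gamma$-a.e. $x\in S$, the cascade is non-explosive for initial state $X_\theta=x$; (b) if, in addition, $p(x_0,dy)\ll\gamma(dy)$ for some $x_0\in S$, then the cascade associated with the initial state $X_\theta=x_0$ is non-explosive.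
   Context: Tree. $\mathbb{T}=\{\theta\}\cup\bigcup_{n\ge1}\{1,2\}^n$ is the full infinite binary tree with root $\theta$; $\partial\mathbb{T}=\{1,2\}^\infty$. For $s\in\partial\mathbb{T}$, $s|n=(s_1,\dots,s_n)$ for $n\ge1$ and $s|0=\theta$. A vertex $v=s|n$ has height $|v|=n$, and $v|j$ ($0\le j\le |v|$) denotes its ancestor of height $j$, with $v|0=\theta$. DSY cascade. $\{T_v\}_{v\in\mathbb{T}}$ is a family of i.i.d. mean-one exponential random variables. A DSY cascade is a family $\{\lambda_v^{-1}T_v\}_{v\in\mathbb{T}}$, where $\{\lambda_v\}_{v\in\mathbb{T}}$ is a family of positive random variables independent of $\{T_v\}_{v\in\mathbb{T}}$. Type $(\mathcal{M})$. The cascade is of type $(\mathcal{M})$ if $\lambda_v=\lambda(X_v)$, where $\lambda:S\to(0,\infty)$ is a measurable function and $\{X_v\}_{v\in\mathbb{T}}$ is a family of random variables such that: (A) for every path $s\in\partial\mathbb{T}$, $X_{s|0},X_{s|1},X_{s|2},\dots$ is a time-homogeneous Markov chain on a measurable space $(S,\mathcal{S})$; (B) the transition probability $p(x,dy)$ of this chain does not depend on $s$. Initial state. "The cascade for (associated with) initial state $X_\theta=x$" means the type $(\mathcal{M})$ DSY cascade with the same $\lambda$ and $p$ and with $X_\theta=x$ almost surely. Explosion. The explosion time is the $[0,\infty]$-valued random variable $\zeta=\sup_{n\ge0}\min_{|v|=n}\sum_{j=0}^n \frac{T_{v|j}}{\lambda_{v|j}}$. The cascade is non-explosive if $\mathbb{P}(\zeta=\infty)=1$.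 Time-reversibility with respect to $\gamma$ means $\gamma(dx)p(x,dy)=\gamma(dy)p(y,dx)$ as measures on $S\times S$. *)

theory Defs
  imports "HOL-Probability.Probability"
begin

section \<open>Markov kernels and Markov chains\<close>

definition markov_kernel :: "'s measure \<Rightarrow> ('s \<Rightarrow> 's measure) \<Rightarrow> bool" where
  "markov_kernel S p \<longleftrightarrow> p \<in> measurable S (prob_algebra S)"

definition chain_history ::
    "'w measure \<Rightarrow> 's measure \<Rightarrow> (nat \<Rightarrow> 'w \<Rightarrow> 's) \<Rightarrow> nat \<Rightarrow> 'w measure" where
  "chain_history M S Y n =
     vimage_algebra (space M) (\<lambda>\<omega>. \<lambda>j\<in>{..n}. Y j \<omega>) (PiM {..n} (\<lambda>_. S))"

definition markov_chain ::
    "'w measure \<Rightarrow> 's measure \<Rightarrow> ('s \<Rightarrow> 's measure) \<Rightarrow> (nat \<Rightarrow> 'w \<Rightarrow> 's) \<Rightarrow> bool" where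
  "markov_chain M S p Y \<longleftrightarrow>
     (\<forall>n. Y n \<in> measurable M S) \<and>
     (\<forall>n. \<forall>B\<in>sets S. AE \<omega> in M.
        real_cond_exp M (chain_history M S Y n) (indicator (Y (Suc n) -` B \<inter> space M)) \<omega>
          = measure (p (Y n \<omega>)) B)"

text \<open>\<open>\<gamma>(dx) p(x,dy)\<close> as a measure on the product space.\<close>

definition joint_law :: "'s measure \<Rightarrow> 's measure \<Rightarrow> ('s \<Rightarrow> 's measure) \<Rightarrow> ('s \<times> 's) measure" where
  "joint_law S \<gamma> p = \<gamma> \<bind> (\<lambda>x. p x \<bind> (\<lambda>y. return (S \<Otimes>\<^sub>M S) (x, y)))"

definition time_reversible :: "'s measure \<Rightarrow> 's measure \<Rightarrow> ('s \<Rightarrow> 's measure) \<Rightarrow> bool" where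
  "time_reversible S \<gamma> p \<longleftrightarrow>
     joint_law S \<gamma> p = distr (joint_law S \<gamma> p) (S \<Otimes>\<^sub>M S) prod.swap"

definition invariant_prob :: "'s measure \<Rightarrow> 's measure \<Rightarrow> ('s \<Rightarrow> 's measure) \<Rightarrow> bool" where
  "invariant_prob S \<gamma> p \<longleftrightarrow> prob_space \<gamma> \<and> sets \<gamma> = sets S \<and> \<gamma> \<bind> p = \<gamma>"

section \<open>Doubly stochastic Yule cascades\<close>

text \<open>
  A vertex of the binary tree is the list of left/right choices leading to it from the root
  \<open>[]\<close>; its height is the length of the list and its ancestor at height \<open>j\<close> is \<open>take j v\<close>.
  A boundary point is a function \<open>s :: nat \<Rightarrow> bool\<close>.
\<close>

type_synonym vertex = "bool list"

definition path_vertex :: "(nat \<Rightarrow> bool) \<Rightarrow> nat \<Rightarrow> vertex" where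
  "path_vertex s n = map s [0..<n]"

locale dsy_cascade = prob_space M
  for M :: "'w measure"
    and T :: "vertex \<Rightarrow> 'w \<Rightarrow> real"
    and \<Lambda> :: "vertex \<Rightarrow> 'w \<Rightarrow> real" +
  assumes clocks_exponential:
      "\<And>v. distributed M lborel (T v) (\<lambda>t. ennreal (exponential_density 1 t))"
    and clocks_independent: "indep_vars (\<lambda>_. borel) T UNIV"
    and intensities_measurable: "\<And>v. \<Lambda> v \<in> borel_measurable M"
    and intensities_positive: "\<And>v \<omega>. \<omega> \<in> space M \<Longrightarrow> \<Lambda> v \<omega> > 0"
    and intensities_indep_clocks:
      "indep_var (PiM UNIV (\<lambda>_. borel)) (\<lambda>\<omega> v. \<Lambda> v \<omega>)
                 (PiM UNIV (\<lambda>_. borel)) (\<lambda>\<omega> v. T v \<omega>)"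

definition explosion_time ::
    "(vertex \<Rightarrow> 'w \<Rightarrow> real) \<Rightarrow> (vertex \<Rightarrow> 'w \<Rightarrow> real) \<Rightarrow> 'w \<Rightarrow> ennreal" where
  "explosion_time T \<Lambda> \<omega> =
     (SUP n. MIN v\<in>{v. length v = n}. ennreal (\<Sum>j\<le>n. T (take j v) \<omega> / \<Lambda> (take j v) \<omega>))"

definition non_explosive ::
    "'w measure \<Rightarrow> (vertex \<Rightarrow> 'w \<Rightarrow> real) \<Rightarrow> (vertex \<Rightarrow> 'w \<Rightarrow> real) \<Rightarrow> bool" where
  "non_explosive M T \<Lambda> \<longleftrightarrow> measure M {\<omega> \<in> space M. explosion_time T \<Lambda> \<omega> = \<infinity>} = 1"

locale dsy_cascade_type_M = dsy_cascade M T "\<lambda>v \<omega>. lam (X v \<omega>)"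
  for M :: "'w measure"
    and S :: "'s measure"
    and lam :: "'s \<Rightarrow> real"
    and p :: "'s \<Rightarrow> 's measure"
    and T :: "vertex \<Rightarrow> 'w \<Rightarrow> real"
    and X :: "vertex \<Rightarrow> 'w \<Rightarrow> 's" +
  assumes intensity_measurable: "lam \<in> borel_measurable S"
    and intensity_positive: "\<And>x. x \<in> space S \<Longrightarrow> lam x > 0"
    and kernel: "markov_kernel S p"
    and markov_along_paths: "\<And>s. markov_chain M S p (\<lambda>n. X (path_vertex s n))"

section \<open>Operators on \<open>L\<^sup>2(\<gamma>)\<close>\<close>

text \<open>
  Elements of the complex Hilbert space \<open>L\<^sup>2(\<gamma>)\<close> are represented by square-integrable functions,
  and equality in \<open>L\<^sup>2(\<gamma>)\<close> is equality \<open>\<gamma>\<close>-almost everywhere.  Complex scalars are needed for the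
  usual notion of spectrum.
\<close>

definition L2_space :: "'s measure \<Rightarrow> ('s \<Rightarrow> complex) set" where
  "L2_space \<gamma> = {f \<in> borel_measurable \<gamma>. integrable \<gamma> (\<lambda>x. (cmod (f x))\<^sup>2)}"

definition L2_norm :: "'s measure \<Rightarrow> ('s \<Rightarrow> complex) \<Rightarrow> real" where
  "L2_norm \<gamma> f = sqrt (LINT x|\<gamma>. (cmod (f x))\<^sup>2)"

text \<open>
  The boundedness and additivity clauses imply that the operator respects \<open>\<gamma>\<close>-a.e. equality.
\<close>

definition L2_bounded_operator ::
    "'s measure \<Rightarrow> (('s \<Rightarrow> complex) \<Rightarrow> 's \<Rightarrow> complex) \<Rightarrow> bool" where
  "L2_bounded_operator \<gamma> A \<longleftrightarrow>
     (\<forall>f\<in>L2_space \<gamma>. A f \<in> L2_space \<gamma>) \<and>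
     (\<forall>f\<in>L2_space \<gamma>. \<forall>g\<in>L2_space \<gamma>. AE x in \<gamma>. A (\<lambda>y. f y + g y) x = A f x + A g x) \<and>
     (\<forall>c. \<forall>f\<in>L2_space \<gamma>. AE x in \<gamma>. A (\<lambda>y. c * f y) x = c * A f x) \<and>
     (\<exists>C. \<forall>f\<in>L2_space \<gamma>. L2_norm \<gamma> (A f) \<le> C * L2_norm \<gamma> f)"

definition L2_operator_norm ::
    "'s measure \<Rightarrow> (('s \<Rightarrow> complex) \<Rightarrow> 's \<Rightarrow> complex) \<Rightarrow> ennreal" where
  "L2_operator_norm \<gamma> A = (SUP f\<in>{f\<in>L2_space \<gamma>. L2_norm \<gamma> f \<le> 1}. ennreal (L2_norm \<gamma> (A f)))"

definition L2_resolvent_set ::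
    "'s measure \<Rightarrow> (('s \<Rightarrow> complex) \<Rightarrow> 's \<Rightarrow> complex) \<Rightarrow> complex set" where
  "L2_resolvent_set \<gamma> A =
     {z. \<exists>R. L2_bounded_operator \<gamma> R \<and>
          (\<forall>f\<in>L2_space \<gamma>. AE x in \<gamma>. R (\<lambda>y. z * f y - A f y) x = f x) \<and>
          (\<forall>f\<in>L2_space \<gamma>. AE x in \<gamma>. z * R f x - A (R f) x = f x)}"

definition L2_spectrum ::
    "'s measure \<Rightarrow> (('s \<Rightarrow> complex) \<Rightarrow> 's \<Rightarrow> complex) \<Rightarrow> complex set" where
  "L2_spectrum \<gamma> A = - L2_resolvent_set \<gamma> A"

definition L2_spectral_radius ::
    "'s measure \<Rightarrow> (('s \<Rightarrow> complex) \<Rightarrow> 's \<Rightarrow> complex) \<Rightarrow> ennreal" where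
  "L2_spectral_radius \<gamma> A = (SUP z\<in>L2_spectrum \<gamma> A. ennreal (cmod z))"

definition cascade_operator ::
    "('s \<Rightarrow> real) \<Rightarrow> ('s \<Rightarrow> 's measure) \<Rightarrow> real \<Rightarrow> ('s \<Rightarrow> complex) \<Rightarrow> 's \<Rightarrow> complex" where
  "cascade_operator lam p a f x =
     complex_of_real (lam x / (a + lam x)) * (LINT y|p x. f y)"

end

theory Submission
  imports Defs "HOL-Complex_Analysis.Complex_Analysis"
begin

text \<open>
  Explosion is excluded by a first-moment argument.  Fix \<open>a > 0\<close> and write \<open>S v\<close> for the sum of
  \<open>T / lam\<close> along the branch from the root to \<open>v\<close>.  If the cascade explodes before time \<open>L\<close>, then every
  level has a vertex with \<open>S v \<le> L\<close>.  Given the intensities, the expectation of \<open>exp (- a S v)\<close> is the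
  product of \<open>lam / (a + lam)\<close> along the branch, so by Markov's inequality the conditional probability
  of explosion before \<open>L\<close> is at most \<open>exp (a L)\<close> times the sum of these products over any one level.
  Hence there is no explosion once these level sums tend to \<open>0\<close> almost surely; this is
  \<open>non_explosive_if_level_weights_vanish\<close>.

  Along one branch the states form a Markov chain, so the expected product over \<open>n\<close> vertices is the
  \<open>n\<close>-th iterate \<open>T\<^sub>a^n 1\<close> of the cascade operator at the initial state (\<open>chain_damping\<close>).
  With \<open>2 ^ n\<close> vertices per level, everything depends on the series \<open>total_mass\<close> with terms
  \<open>2 ^ n * T\<^sub>a^n 1\<close>: if it is almost surely finite at the states of some fixed level of the
  tree, then the level sums tend to \<open>0\<close> (\<open>level_weights_vanish\<close>).  For part (a) that level is the root; for part (b) it is the first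
  generation, whose states have law \<open>p x\<^sub>0\<close> and so inherit every \<open>\<gamma>\<close>-almost sure property.

  It remains to see that \<open>total_mass\<close> is finite \<open>\<gamma>\<close>-almost everywhere, and for this it suffices that
  \<open>(\<Sum>n. 2 ^ n * c n)\<close> converges, where \<open>c n\<close> is the \<open>\<gamma>\<close>-integral of \<open>T\<^sub>a^n 1\<close>.  If the operator norm is
  \<open>q < 1/2\<close>, then \<open>c n \<le> q ^ n\<close> by Cauchy-Schwarz.  If only the spectral radius is below \<open>r < 1/2\<close>, then
  the integral of the resolvent \<open>(z - T\<^sub>a)\<^sup>-\<^sup>1 1\<close> is holomorphic for \<open>cmod z > r\<close> and has the expansion
  \<open>(\<Sum>n. c n / z ^ (n + 1))\<close> near infinity, which forces the power series with coefficients \<open>c n\<close> to have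
  radius of convergence at least \<open>1 / r > 2\<close> (\<open>iterate_integrals_conv_radius\<close>).
\<close>

section \<open>Explosion and the levels of the tree\<close>

text \<open>
  For frozen intensities \<open>l\<close> this is the Laplace transform at \<open>a\<close> of the total waiting
  time along the branch from the root to \<open>v\<close>: each clock \<open>T / l\<close> contributes a factor \<open>l / (a + l)\<close>.
\<close>
definition vertex_weight :: "real \<Rightarrow> (vertex \<Rightarrow> real) \<Rightarrow> vertex \<Rightarrow> real" where
  "vertex_weight a l v = (\<Prod>j\<le>length v. l (take j v) / (a + l (take j v)))"

lemma finite_level: "finite {v :: vertex. length v = n}"
  using finite_lists_length_eq[of "UNIV :: bool set" n] by simp

lemma level_nonempty: "\<exists>v :: vertex. length v = n"
  by (rule exI[of _ "replicate n True"]) simp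

lemma card_level: "card {v :: vertex. length v = n} = 2 ^ n"
  using card_lists_length_eq[of "UNIV :: bool set" n] by simp

text \<open>
  This form of the event has only countable quantifiers over real inequalities, so it is visibly
  measurable in the clocks and intensities, and its negation at a fixed \<open>L\<close> is a union bound away
  from the vertex weights.
\<close>
lemma explosion_time_eq_top_iff:
  "explosion_time T \<Lambda> \<omega> = \<infinity> \<longleftrightarrow>
     (\<forall>L :: nat. \<exists>n. \<forall>v. length v = n \<longrightarrow> real L < (\<Sum>j\<le>n. T (take j v) \<omega> / \<Lambda> (take j v) \<omega>))"
    (is "?l \<longleftrightarrow> ?r")
proof -
  have *: "ennreal (real L) < (MIN v\<in>{v. length v = n}. ennreal (f v)) \<longleftrightarrow>
           (\<forall>v. length v = n \<longrightarrow> real L < f v)" for L n and f :: "vertex \<Rightarrow> real"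
    by (subst Min_gr_iff) (auto simp: finite_level level_nonempty ennreal_less_iff)
  have "?r \<longleftrightarrow> (\<forall>L :: nat. ennreal (real L) < explosion_time T \<Lambda> \<omega>)"
    unfolding explosion_time_def less_SUP_iff by (simp add: *)
  also have "\<dots> \<longleftrightarrow> ?l"
  proof
    assume L: "\<forall>L :: nat. ennreal (real L) < explosion_time T \<Lambda> \<omega>"
    show ?l
    proof (rule ccontr)
      assume "\<not> ?l"
      then obtain x where x: "explosion_time T \<Lambda> \<omega> = ennreal x" "0 \<le> x"
        by (cases "explosion_time T \<Lambda> \<omega>") auto
      obtain L :: nat where "x \<le> real L" using real_arch_simple by blast
      then show False using L[rule_format, of L] x by (simp add: ennreal_less_iff)
    qed
  qed (simp add: ennreal_of_nat_eq_real_of_nat[symmetric] of_nat_less_top)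
  finally show ?thesis by simp
qed

section \<open>Clocks with frozen intensities\<close>

lemma exponential_laplace:
  assumes "distributed M lborel X (\<lambda>t. ennreal (exponential_density 1 t))" and "0 \<le> s"
  shows "(\<integral>\<^sup>+\<omega>. ennreal (exp (- s * X \<omega>)) \<partial>M) = ennreal (1 / (1 + s))"
proof -
  have "(\<integral>\<^sup>+\<omega>. ennreal (exp (- s * X \<omega>)) \<partial>M)
      = (\<integral>\<^sup>+t. ennreal (exponential_density 1 t) * ennreal (exp (- s * t)) \<partial>lborel)"
    by (rule distributed_nn_integral[OF assms(1), symmetric]) simp
  also have "\<dots> = (\<integral>\<^sup>+t. ennreal (1 / (1 + s)) * ennreal (exponential_density (1 + s) t) \<partial>lborel)"
  proof (intro nn_integral_cong)
    fix t :: real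
    have "exp (- t) * exp (- s * t) = 1 / (1 + s) * ((1 + s) * exp (- t * (1 + s)))"
      using assms(2) by (simp add: exp_add[symmetric]) (simp add: algebra_simps)
    then show "ennreal (exponential_density 1 t) * ennreal (exp (- s * t))
        = ennreal (1 / (1 + s)) * ennreal (exponential_density (1 + s) t)"
      using assms(2) by (simp add: exponential_density_def ennreal_mult[symmetric])
  qed
  also have "\<dots> = ennreal (1 / (1 + s)) * (\<integral>\<^sup>+t. ennreal (exponential_density (1 + s) t) \<partial>lborel)"
    by (rule nn_integral_cmult) simp
  also have "(\<integral>\<^sup>+t. ennreal (exponential_density (1 + s) t) \<partial>lborel) = 1"
    using prob_space.emeasure_space_1[OF prob_space_exponential_density[of "1 + s"]] assms(2)
    by (simp add: emeasure_density)
  finally show ?thesis by simp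
qed

context dsy_cascade
begin

lemma clock_measurable [measurable]: "T v \<in> borel_measurable M"
  using distributed_measurable[OF clocks_exponential] by simp

text \<open>
  The ancestors of \<open>v\<close> are distinct vertices, so their clocks are independent and the Laplace
  transform factorises.
\<close>
lemma discounted_clock_sum:
  assumes l: "\<And>v. 0 < l v" and a: "0 < a"
  shows "(\<integral>\<^sup>+\<omega>. ennreal (exp (- a * (\<Sum>j\<le>length v. T (take j v) \<omega> / l (take j v)))) \<partial>M)
       = ennreal (vertex_weight a l v)"
proof -
  define I where "I = (\<lambda>j. take j v) ` {..length v}"
  have inj: "inj_on (\<lambda>j. take j v) {..length v}"
    by (rule inj_onI) (metis atMost_iff length_take min.absorb2)
  have "indep_vars (\<lambda>_. borel) (\<lambda>u \<omega>. ennreal (exp (- (a / l u) * T u \<omega>))) I"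
    by (rule indep_vars_compose2[OF indep_vars_subset[OF clocks_independent subset_UNIV]]) measurable
  then have "(\<integral>\<^sup>+\<omega>. (\<Prod>u\<in>I. ennreal (exp (- (a / l u) * T u \<omega>))) \<partial>M)
      = (\<Prod>u\<in>I. \<integral>\<^sup>+\<omega>. ennreal (exp (- (a / l u) * T u \<omega>)) \<partial>M)"
    by (intro indep_vars_nn_integral) (auto simp: I_def)
  also have "\<dots> = (\<Prod>u\<in>I. ennreal (l u / (a + l u)))"
  proof (rule prod.cong[OF refl])
    fix u
    have "1 / (1 + a / l u) = l u / (a + l u)"
      using l[of u] a by (simp add: field_simps)
    then show "(\<integral>\<^sup>+\<omega>. ennreal (exp (- (a / l u) * T u \<omega>)) \<partial>M) = ennreal (l u / (a + l u))"
      using exponential_laplace[OF clocks_exponential, of "a / l u" u] l[of u] a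
      by (simp add: less_imp_le)
  qed
  also have "\<dots> = ennreal (vertex_weight a l v)"
    using l a unfolding vertex_weight_def I_def
    by (subst prod.reindex[OF inj]) (simp add: prod_ennreal less_imp_le add_nonneg_nonneg)
  finally have "(\<integral>\<^sup>+\<omega>. (\<Prod>u\<in>I. ennreal (exp (- (a / l u) * T u \<omega>))) \<partial>M)
      = ennreal (vertex_weight a l v)" .
  moreover have "(\<Prod>u\<in>I. ennreal (exp (- (a / l u) * T u \<omega>)))
      = ennreal (exp (- a * (\<Sum>j\<le>length v. T (take j v) \<omega> / l (take j v))))" for \<omega>
    unfolding I_def
    by (subst prod.reindex[OF inj]) (simp add: prod_ennreal exp_sum[symmetric] sum_negf sum_distrib_left)
  ultimately show ?thesis by simp
qed

text \<open>
  Markov's inequality for \<open>exp (- a S)\<close> at each vertex of the level, where \<open>S\<close> is the passage time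
  of the vertex, followed by a union bound.
\<close>
lemma prob_early_vertex_le:
  assumes l: "\<And>v. 0 < l v" and a: "0 < a"
  shows "emeasure M {\<omega> \<in> space M. \<exists>v. length v = n \<and> (\<Sum>j\<le>n. T (take j v) \<omega> / l (take j v)) \<le> L}
       \<le> ennreal (exp (a * L) * (\<Sum>v | length v = n. vertex_weight a l v))"
proof -
  define S where "S v \<omega> = (\<Sum>j\<le>length v. T (take j v) \<omega> / l (take j v))" for v \<omega>
  have [measurable]: "S v \<in> borel_measurable M" for v
    unfolding S_def by measurable
  have wt: "0 \<le> vertex_weight a l v" for v
    unfolding vertex_weight_def using l a by (intro prod_nonneg) (simp add: less_imp_le add_nonneg_nonneg)
  have "emeasure M {\<omega> \<in> space M. \<exists>v. length v = n \<and> (\<Sum>j\<le>n. T (take j v) \<omega> / l (take j v)) \<le> L}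
      = emeasure M (\<Union>v\<in>{v. length v = n}. {\<omega> \<in> space M. S v \<omega> \<le> L})"
    by (rule arg_cong[where f = "emeasure M"]) (auto simp: S_def)
  also have "\<dots> \<le> (\<Sum>v | length v = n. emeasure M {\<omega> \<in> space M. S v \<omega> \<le> L})"
    by (rule emeasure_subadditive_finite) (auto simp: finite_level)
  also have "\<dots> \<le> (\<Sum>v | length v = n. ennreal (exp (a * L)) * ennreal (vertex_weight a l v))"
  proof (rule sum_mono)
    fix v
    have "emeasure M {\<omega> \<in> space M. S v \<omega> \<le> L} = (\<integral>\<^sup>+\<omega>. indicator {\<omega> \<in> space M. S v \<omega> \<le> L} \<omega> \<partial>M)"
      by simp
    also have "\<dots> \<le> (\<integral>\<^sup>+\<omega>. ennreal (exp (a * L)) * ennreal (exp (- a * S v \<omega>)) \<partial>M)"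
      using a
      by (intro nn_integral_mono)
         (auto simp: indicator_def ennreal_mult[symmetric] exp_add[symmetric] simp flip: ennreal_1)
    also have "\<dots> = ennreal (exp (a * L)) * (\<integral>\<^sup>+\<omega>. ennreal (exp (- a * S v \<omega>)) \<partial>M)"
      by (rule nn_integral_cmult) measurable
    also have "\<dots> = ennreal (exp (a * L)) * ennreal (vertex_weight a l v)"
      unfolding S_def by (rule arg_cong[OF discounted_clock_sum[OF l a]])
    finally show "emeasure M {\<omega> \<in> space M. S v \<omega> \<le> L} \<le> \<dots>" .
  qed
  also have "\<dots> = ennreal (exp (a * L) * (\<Sum>v | length v = n. vertex_weight a l v))"
    using wt by (simp add: ennreal_mult[symmetric] sum_distrib_left[symmetric] sum_nonneg)
  finally show ?thesis .
qed

lemma fixed_intensities_non_explosive: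
  assumes l: "\<And>v. 0 < l v" and a: "0 < a"
    and lim: "(\<lambda>n. \<Sum>v | length v = n. vertex_weight a l v) \<longlonglongrightarrow> 0"
  shows "AE \<omega> in M. explosion_time T (\<lambda>v _. l v) \<omega> = \<infinity>"
proof -
  have "AE \<omega> in M. \<exists>n. \<forall>v. length v = n \<longrightarrow> real L < (\<Sum>j\<le>n. T (take j v) \<omega> / l (take j v))" for L :: nat
  proof -
    define E where "E n = {\<omega> \<in> space M. \<exists>v. length v = n \<and> (\<Sum>j\<le>n. T (take j v) \<omega> / l (take j v)) \<le> L}" for n
    have E [measurable]: "E n \<in> sets M" for n
      unfolding E_def by measurable
    have "emeasure M (\<Inter>n. E n) \<le> ennreal (exp (a * L) * (\<Sum>v | length v = n. vertex_weight a l v))" for n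
    proof -
      have "emeasure M (\<Inter>n. E n) \<le> emeasure M (E n)"
        by (rule emeasure_mono) auto
      also have "\<dots> \<le> ennreal (exp (a * L) * (\<Sum>v | length v = n. vertex_weight a l v))"
        unfolding E_def by (rule prob_early_vertex_le[OF l a])
      finally show ?thesis .
    qed
    moreover have "(\<lambda>n. ennreal (exp (a * L) * (\<Sum>v | length v = n. vertex_weight a l v))) \<longlonglongrightarrow> ennreal 0"
      using tendsto_mult[OF tendsto_const lim, of "exp (a * L)"] by (intro tendsto_ennrealI) simp
    ultimately have "emeasure M (\<Inter>n. E n) \<le> ennreal 0"
      by (intro LIMSEQ_le_const) auto
    then have "emeasure M (\<Inter>n. E n) = 0"
      by simp
    then have "AE \<omega> in M. \<omega> \<notin> (\<Inter>n. E n)"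
      by (intro AE_not_in null_setsI) auto
    then show ?thesis
      by (rule AE_mp) (auto simp: E_def not_le intro!: AE_I2)
  qed
  then show ?thesis
    unfolding explosion_time_eq_top_iff by (simp only: AE_all_countable) simp
qed

text \<open>
  Only the intensities, and not the states that produce them, are independent of the clocks.
  Disintegrating the joint law of (intensities, clocks) as a product therefore reduces the claim to
  frozen intensities, and what remains to be controlled is a functional of the intensities alone.
\<close>

theorem non_explosive_if_level_weights_vanish:
  assumes a: "0 < a"
    and lim: "AE \<omega> in M. (\<lambda>n. \<Sum>v | length v = n. vertex_weight a (\<lambda>u. \<Lambda> u \<omega>) v) \<longlonglongrightarrow> 0"
  shows "non_explosive M T \<Lambda>"
proof -
  define Q where "Q = (PiM UNIV (\<lambda>_. borel) :: (vertex \<Rightarrow> real) measure)"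
  define DL where "DL = distr M Q (\<lambda>\<omega> v. \<Lambda> v \<omega>)"
  define DT where "DT = distr M Q (\<lambda>\<omega> v. T v \<omega>)"
  define expl where "expl l t \<longleftrightarrow> (\<forall>L :: nat. \<exists>n. \<forall>v. length v = n \<longrightarrow>
      real L < (\<Sum>j\<le>n. t (take j v) / l (take j v)))" for l t :: "vertex \<Rightarrow> real"
  note intensities_measurable [measurable]
  have coord [measurable]: "(\<lambda>l. l v) \<in> borel_measurable Q" for v
    unfolding Q_def by measurable
  have spQ [simp]: "space Q = UNIV"
    by (simp add: Q_def space_PiM)
  have mL [measurable]: "(\<lambda>\<omega> v. \<Lambda> v \<omega>) \<in> measurable M Q"
    unfolding Q_def by (rule measurable_PiM_single') (auto simp: intensities_measurable)
  have mT [measurable]: "(\<lambda>\<omega> v. T v \<omega>) \<in> measurable M Q"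
    unfolding Q_def by (rule measurable_PiM_single') auto
  interpret DL: prob_space DL unfolding DL_def by (rule prob_space_distr) measurable
  interpret DT: prob_space DT unfolding DT_def by (rule prob_space_distr) measurable
  interpret DLT: pair_prob_space DL DT ..
  have sDL [measurable_cong]: "sets DL = sets Q" by (simp add: DL_def)
  have sDT [measurable_cong]: "sets DT = sets Q" by (simp add: DT_def)
  \<comment> \<open>Positivity must be restated on the law, because \<open>Q\<close> also contains families with nonpositive entries.\<close>
  have good: "AE l in DL. (\<forall>v. 0 < l v) \<and> (\<lambda>n. \<Sum>v | length v = n. vertex_weight a l v) \<longlonglongrightarrow> 0"
    unfolding DL_def
  proof (subst AE_distr_iff)
    have [measurable]: "(\<lambda>l. vertex_weight a l v) \<in> borel_measurable Q" for v
      unfolding vertex_weight_def by measurable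
    have [measurable]: "{l \<in> space Q. (\<lambda>n. \<Sum>v | length v = n. vertex_weight a l v) \<longlonglongrightarrow> 0} \<in> sets Q"
      by measurable
    show "{l \<in> space Q. (\<forall>v. 0 < l v) \<and> (\<lambda>n. \<Sum>v | length v = n. vertex_weight a l v) \<longlonglongrightarrow> 0} \<in> sets Q"
      by measurable
  qed (use lim intensities_positive in auto)
  have fixed: "AE t in DT. expl l t"
    if "\<forall>v. 0 < l v" "(\<lambda>n. \<Sum>v | length v = n. vertex_weight a l v) \<longlonglongrightarrow> 0" for l
  proof -
    have "AE \<omega> in M. expl l (\<lambda>v. T v \<omega>)"
      using fixed_intensities_non_explosive[of l, OF _ a that(2)] that(1)
      unfolding explosion_time_eq_top_iff expl_def by blast
    moreover have "{t \<in> space Q. expl l t} \<in> sets Q"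
      unfolding expl_def by measurable
    ultimately show ?thesis
      unfolding DT_def by (subst AE_distr_iff) auto
  qed
  have "AE z in DL \<Otimes>\<^sub>M DT. expl (fst z) (snd z)"
  proof (rule DLT.AE_pair_measure)
    show "{z \<in> space (DL \<Otimes>\<^sub>M DT). expl (fst z) (snd z)} \<in> sets (DL \<Otimes>\<^sub>M DT)"
      unfolding expl_def by measurable
    show "AE l in DL. AE t in DT. expl (fst (l, t)) (snd (l, t))"
      using good by eventually_elim (simp add: fixed)
  qed
  also have "DL \<Otimes>\<^sub>M DT = distr M (Q \<Otimes>\<^sub>M Q) (\<lambda>\<omega>. (\<lambda>v. \<Lambda> v \<omega>, \<lambda>v. T v \<omega>))"
    using intensities_indep_clocks
    unfolding indep_var_distribution_eq DL_def DT_def Q_def by simp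
  finally have "AE z in distr M (Q \<Otimes>\<^sub>M Q) (\<lambda>\<omega>. (\<lambda>v. \<Lambda> v \<omega>, \<lambda>v. T v \<omega>)). expl (fst z) (snd z)" .
  moreover have "{z \<in> space (Q \<Otimes>\<^sub>M Q). expl (fst z) (snd z)} \<in> sets (Q \<Otimes>\<^sub>M Q)"
    unfolding expl_def by measurable
  ultimately have "AE \<omega> in M. expl (\<lambda>v. \<Lambda> v \<omega>) (\<lambda>v. T v \<omega>)"
    by (subst (asm) AE_distr_iff) auto
  then have "AE \<omega> in M. explosion_time T \<Lambda> \<omega> = \<infinity>"
    unfolding explosion_time_eq_top_iff expl_def .
  moreover have "{\<omega> \<in> space M. explosion_time T \<Lambda> \<omega> = \<infinity>} \<in> sets M"
    unfolding explosion_time_eq_top_iff by measurable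
  ultimately show ?thesis
    unfolding non_explosive_def by (simp add: prob_Collect_eq_1)
qed

end

section \<open>Markov chains\<close>

lemma markov_kernelD:
  assumes "markov_kernel S p" and "x \<in> space S"
  shows "prob_space (p x)" and "sets (p x) = sets S" and "space (p x) = space S"
proof -
  have "p x \<in> space (prob_algebra S)"
    using assms unfolding markov_kernel_def by (rule measurable_space)
  then show "prob_space (p x)" "sets (p x) = sets S"
    by (auto simp: space_prob_algebra)
  then show "space (p x) = space S"
    by (intro sets_eq_imp_space_eq)
qed

lemma markov_kernel_subprob:
  "markov_kernel S p \<Longrightarrow> p \<in> measurable S (subprob_algebra S)"
  unfolding markov_kernel_def by (rule measurable_prob_algebraD)

lemma chain_measurable_history:
  assumes "markov_chain M S p Y" and "j \<le> k"
  shows "Y j \<in> measurable (chain_history M S Y k) S"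
proof -
  have Y: "Y i \<in> measurable M S" for i
    using assms(1) by (simp add: markov_chain_def)
  have "(\<lambda>\<omega>. \<lambda>j\<in>{..k}. Y j \<omega>) \<in> measurable (chain_history M S Y k) (PiM {..k} (\<lambda>_. S))"
    unfolding chain_history_def
    by (rule measurable_vimage_algebra1)
       (auto simp: space_PiM split: if_splits intro: measurable_space[OF Y])
  moreover have "(\<lambda>f. f j) \<in> measurable (PiM {..k} (\<lambda>_. S)) S"
    using assms(2) by (intro measurable_component_singleton) simp
  ultimately have "(\<lambda>\<omega>. (\<lambda>j\<in>{..k}. Y j \<omega>) j) \<in> measurable (chain_history M S Y k) S"
    by (rule measurable_compose)
  then show ?thesis using assms(2) by simp
qed

lemma subalgebra_chain_history:
  assumes "markov_chain M S p Y"
  shows "subalgebra M (chain_history M S Y k)"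
proof -
  have Y [measurable]: "Y i \<in> measurable M S" for i
    using assms by (simp add: markov_chain_def)
  have "(\<lambda>\<omega>. \<lambda>j\<in>{..k}. Y j \<omega>) \<in> measurable M (PiM {..k} (\<lambda>_. S))"
    by measurable
  then show ?thesis
    unfolding subalgebra_def chain_history_def by (simp add: sets_image_in_sets)
qed

text \<open>
  The chain is specified through conditional probabilities of single sets.  Weighting \<open>M\<close> by the
  density \<open>U\<close>, that specification says that two measures on \<open>S\<close> agree on every measurable set; the
  identity for a general integrand \<open>H\<close> is then an equality of integrals against the same measure.
\<close>
lemma markov_property_nn_integral:
  fixes U :: "'w \<Rightarrow> real" and H :: "'s \<Rightarrow> ennreal"
  assumes M: "prob_space M" and p: "markov_kernel S p" and Y: "markov_chain M S p Y"
    and U: "U \<in> borel_measurable (chain_history M S Y k)"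
    and U01: "\<And>\<omega>. \<omega> \<in> space M \<Longrightarrow> 0 \<le> U \<omega> \<and> U \<omega> \<le> 1"
    and H [measurable]: "H \<in> borel_measurable S"
  shows "(\<integral>\<^sup>+\<omega>. ennreal (U \<omega>) * H (Y (Suc k) \<omega>) \<partial>M)
       = (\<integral>\<^sup>+\<omega>. ennreal (U \<omega>) * (\<integral>\<^sup>+y. H y \<partial>p (Y k \<omega>)) \<partial>M)"
proof -
  interpret prob_space M by (rule M)
  note sub = subalgebra_chain_history[OF Y, of k]
  interpret F: finite_measure_subalgebra M "chain_history M S Y k"
    by (unfold_locales) (rule sub)
  have Y_meas [measurable]: "Y i \<in> measurable M S" for i
    using Y by (simp add: markov_chain_def)
  have [measurable]: "U \<in> borel_measurable M"
    by (rule measurable_from_subalg[OF sub U])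
  note markov_kernel_subprob[OF p, measurable]
  define D where "D = density M (\<lambda>\<omega>. ennreal (U \<omega>))"
  have sD [measurable_cong]: "sets D = sets M" by (simp add: D_def)
  have spD: "space D = space M" by (simp add: D_def)
  have eq: "distr D S (Y (Suc k)) = D \<bind> (\<lambda>\<omega>. p (Y k \<omega>))"
  proof (rule measure_eqI)
    have sets_bind': "sets (D \<bind> (\<lambda>\<omega>. p (Y k \<omega>))) = sets S"
      using not_empty
      by (intro sets_bind) (auto simp: spD markov_kernelD(2)[OF p] measurable_space[OF Y_meas])
    then show "sets (distr D S (Y (Suc k))) = sets (D \<bind> (\<lambda>\<omega>. p (Y k \<omega>)))" by simp
    fix B assume "B \<in> sets (distr D S (Y (Suc k)))"
    then have B [measurable]: "B \<in> sets S" by simp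
    define I :: "'w \<Rightarrow> real" where "I = indicator (Y (Suc k) -` B \<inter> space M)"
    have I [measurable]: "I \<in> borel_measurable M"
      unfolding I_def by measurable
    have UI: "integrable M (\<lambda>\<omega>. U \<omega> * I \<omega>)"
      by (rule integrable_const_bound[where B = 1])
         (use U01 in \<open>auto simp: I_def indicator_def\<close>)
    have ce: "AE \<omega> in M. real_cond_exp M (chain_history M S Y k) I \<omega> = measure (p (Y k \<omega>)) B"
      using Y B unfolding markov_chain_def I_def by blast
    have pB: "prob_space (p (Y k \<omega>))" if "\<omega> \<in> space M" for \<omega>
      using markov_kernelD(1)[OF p measurable_space[OF Y_meas that]] .
    have "emeasure (distr D S (Y (Suc k))) B = (\<integral>\<^sup>+\<omega>. ennreal (U \<omega>) * indicator (Y (Suc k) -` B \<inter> space M) \<omega> \<partial>M)"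
      by (simp add: emeasure_distr spD) (simp add: D_def emeasure_density)
    also have "\<dots> = (\<integral>\<^sup>+\<omega>. ennreal (U \<omega> * I \<omega>) \<partial>M)"
      by (intro nn_integral_cong) (auto simp: I_def indicator_def)
    also have "\<dots> = ennreal (\<integral>\<omega>. U \<omega> * I \<omega> \<partial>M)"
      using U01 by (intro nn_integral_eq_integral[OF UI]) (auto simp: I_def)
    also have "(\<integral>\<omega>. U \<omega> * I \<omega> \<partial>M) = (\<integral>\<omega>. U \<omega> * real_cond_exp M (chain_history M S Y k) I \<omega> \<partial>M)"
      by (rule F.real_cond_exp_intg(2)[OF UI U I, symmetric])
    also have "\<dots> = (\<integral>\<omega>. U \<omega> * measure (p (Y k \<omega>)) B \<partial>M)"
      using ce by (intro integral_cong_AE) auto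
    also have "ennreal \<dots> = (\<integral>\<^sup>+\<omega>. ennreal (U \<omega> * measure (p (Y k \<omega>)) B) \<partial>M)"
    proof (rule nn_integral_eq_integral[symmetric])
      show "integrable M (\<lambda>\<omega>. U \<omega> * measure (p (Y k \<omega>)) B)"
        by (rule integrable_const_bound[where B = 1])
           (use U01 pB in \<open>auto intro!: mult_le_one prob_space.prob_le_1 simp: abs_mult\<close>)
    qed (use U01 in auto)
    also have "\<dots> = (\<integral>\<^sup>+\<omega>. ennreal (U \<omega>) * emeasure (p (Y k \<omega>)) B \<partial>M)"
    proof (intro nn_integral_cong)
      fix \<omega> assume \<omega>: "\<omega> \<in> space M"
      interpret P: prob_space "p (Y k \<omega>)" by (rule pB[OF \<omega>])
      show "ennreal (U \<omega> * measure (p (Y k \<omega>)) B) = ennreal (U \<omega>) * emeasure (p (Y k \<omega>)) B"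
        using U01[OF \<omega>] by (simp add: ennreal_mult P.emeasure_eq_measure)
    qed
    also have "\<dots> = (\<integral>\<^sup>+\<omega>. emeasure (p (Y k \<omega>)) B \<partial>D)"
      unfolding D_def by (subst nn_integral_density) auto
    also have "\<dots> = emeasure (D \<bind> (\<lambda>\<omega>. p (Y k \<omega>))) B"
      using not_empty by (intro emeasure_bind[where N = S, symmetric]) (auto simp: spD)
    finally show "emeasure (distr D S (Y (Suc k))) B = emeasure (D \<bind> (\<lambda>\<omega>. p (Y k \<omega>))) B" .
  qed
  have "(\<integral>\<^sup>+\<omega>. ennreal (U \<omega>) * H (Y (Suc k) \<omega>) \<partial>M) = (\<integral>\<^sup>+\<omega>. H (Y (Suc k) \<omega>) \<partial>D)"
    unfolding D_def by (subst nn_integral_density) auto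
  also have "\<dots> = (\<integral>\<^sup>+y. H y \<partial>distr D S (Y (Suc k)))"
    by (subst nn_integral_distr) auto
  also have "\<dots> = (\<integral>\<^sup>+\<omega>. \<integral>\<^sup>+y. H y \<partial>p (Y k \<omega>) \<partial>D)"
    unfolding eq by (subst nn_integral_bind[where B = S]) auto
  also have "\<dots> = (\<integral>\<^sup>+\<omega>. ennreal (U \<omega>) * (\<integral>\<^sup>+y. H y \<partial>p (Y k \<omega>)) \<partial>M)"
    unfolding D_def by (subst nn_integral_density) auto
  finally show ?thesis .
qed

section \<open>The damped kernel\<close>

text \<open>
  The \<open>n\<close>-th iterate of \<open>f \<mapsto> lam / (a + lam) * p f\<close> on the constant function \<open>1\<close>: the expectation of
  the product of \<open>lam / (a + lam)\<close> over the first \<open>n\<close> states of the chain started at \<open>x\<close>.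
\<close>
primrec damped_mass :: "('s \<Rightarrow> real) \<Rightarrow> ('s \<Rightarrow> 's measure) \<Rightarrow> real \<Rightarrow> nat \<Rightarrow> 's \<Rightarrow> real" where
  "damped_mass lam p a 0 x = 1"
| "damped_mass lam p a (Suc n) x = lam x / (a + lam x) * (LINT y|p x. damped_mass lam p a n y)"

locale damped_kernel =
  fixes S :: "'s measure" and lam :: "'s \<Rightarrow> real" and p :: "'s \<Rightarrow> 's measure" and a :: real
  assumes lam_measurable [measurable]: "lam \<in> borel_measurable S"
    and lam_positive: "\<And>x. x \<in> space S \<Longrightarrow> 0 < lam x"
    and kernel: "markov_kernel S p"
    and a_positive: "0 < a"
begin

abbreviation damping :: "'s \<Rightarrow> real" where "damping x \<equiv> lam x / (a + lam x)"
abbreviation mass :: "nat \<Rightarrow> 's \<Rightarrow> real" where "mass \<equiv> damped_mass lam p a"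

text \<open>
  A level of the tree has \<open>2 ^ n\<close> vertices, so this dominates the expected sum of all vertex weights
  of a cascade started at \<open>x\<close>.
\<close>
definition total_mass :: "'s \<Rightarrow> ennreal" where
  "total_mass x = (\<Sum>n. ennreal (2 ^ n * mass n x))"

lemma damping_bounds: "x \<in> space S \<Longrightarrow> 0 < damping x" "x \<in> space S \<Longrightarrow> damping x < 1"
  using lam_positive[of x] a_positive by (auto simp: field_simps)

lemma kernel_subprob [measurable]: "p \<in> measurable S (subprob_algebra S)"
  by (rule markov_kernel_subprob[OF kernel])

lemma damped_mass_measurable [measurable]: "mass n \<in> borel_measurable S"
proof (induction n)
  case (Suc n)
  note [measurable] = Suc
  have "(\<lambda>x. LINT y|p x. mass n y) \<in> borel_measurable S"
    by (rule measurable_compose[OF kernel_subprob integral_measurable_subprob_algebra]) measurable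
  then show ?case by (simp add: fun_eq_iff[symmetric] cong: measurable_cong)
qed simp

lemma damped_mass_bounds: "x \<in> space S \<Longrightarrow> 0 \<le> mass n x \<and> mass n x \<le> 1"
proof (induction n arbitrary: x)
  case (Suc n)
  interpret P: prob_space "p x" by (rule markov_kernelD(1)[OF kernel Suc.prems])
  have "0 \<le> (LINT y|p x. mass n y)"
    using Suc by (intro integral_nonneg_AE AE_I2) (auto simp: markov_kernelD(3)[OF kernel Suc.prems])
  moreover have "(LINT y|p x. mass n y) \<le> 1"
    using Suc
    by (intro P.integral_le_const P.integrable_const_bound[where B = 1] AE_I2)
       (auto simp: markov_kernelD[OF kernel Suc.prems] cong: measurable_cong_sets)
  ultimately show ?case
    using damping_bounds[OF Suc.prems] by (auto intro!: mult_le_one simp del: times_divide_eq_left)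
qed simp

lemma integrable_damped_mass:
  assumes "finite_measure N" and sN [measurable_cong]: "sets N = sets S"
  shows "integrable N (mass n)"
proof -
  interpret finite_measure N by fact
  show ?thesis
    using damped_mass_bounds sets_eq_imp_space_eq[OF sN]
    by (intro integrable_const_bound[where B = 1] AE_I2) auto
qed

lemma ennreal_damped_mass_Suc:
  assumes x: "x \<in> space S"
  shows "ennreal (mass (Suc n) x) = ennreal (damping x) * (\<integral>\<^sup>+y. ennreal (mass n y) \<partial>p x)"
proof -
  interpret P: prob_space "p x" by (rule markov_kernelD(1)[OF kernel x])
  have "(\<integral>\<^sup>+y. ennreal (mass n y) \<partial>p x) = ennreal (LINT y|p x. mass n y)"
    using damped_mass_bounds
    by (intro nn_integral_eq_integral integrable_damped_mass AE_I2)
       (auto simp: markov_kernelD[OF kernel x] P.finite_measure_axioms)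
  then show ?thesis
    using damping_bounds[OF x] by (simp add: ennreal_mult' del: times_divide_eq_left)
qed

lemma total_mass_measurable [measurable]: "total_mass \<in> borel_measurable S"
  unfolding total_mass_def by measurable

text \<open>
  The Markov property integrates out the last state of a damped path and turns it into one more
  iteration of the damped kernel; the statement leaves \<open>k\<close> free so that the induction can pass these
  iterations backwards along the path.
\<close>
lemma chain_damping:
  assumes M: "prob_space M" and Y: "markov_chain M S p Y"
    and w [measurable]: "w \<in> borel_measurable S" and w01: "\<And>x. 0 \<le> w x \<and> w x \<le> 1"
  shows "(\<integral>\<^sup>+\<omega>. ennreal (w (Y m \<omega>) * (\<Prod>j\<in>{m..<m+n}. damping (Y j \<omega>))) * ennreal (mass k (Y (m + n) \<omega>)) \<partial>M)
       = (\<integral>\<^sup>+\<omega>. ennreal (w (Y m \<omega>) * mass (n + k) (Y m \<omega>)) \<partial>M)"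
proof (induction n arbitrary: k)
  case 0
  show ?case using w01 by (simp add: ennreal_mult')
next
  case (Suc n)
  have Y_space: "Y j \<omega> \<in> space S" if "\<omega> \<in> space M" for j \<omega>
    using Y that unfolding markov_chain_def by (blast dest: measurable_space)
  define V where "V \<omega> = w (Y m \<omega>) * (\<Prod>j\<in>{m..<m+n}. damping (Y j \<omega>))" for \<omega>
  have prod01: "0 \<le> (\<Prod>j\<in>A. damping (Y j \<omega>)) \<and> (\<Prod>j\<in>A. damping (Y j \<omega>)) \<le> 1" if "\<omega> \<in> space M" for A \<omega>
    using damping_bounds[OF Y_space[OF that]]
    by (auto intro!: prod_nonneg prod_le_1 simp: less_imp_le simp del: times_divide_eq_left)
  have U: "(\<lambda>\<omega>. V \<omega> * damping (Y (m + n) \<omega>)) \<in> borel_measurable (chain_history M S Y (m + n))"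
  proof -
    have Yh: "Y j \<in> measurable (chain_history M S Y (m + n)) S" if "j \<le> m + n" for j
      by (rule chain_measurable_history[OF Y that])
    have g: "(\<lambda>\<omega>. damping (Y j \<omega>)) \<in> borel_measurable (chain_history M S Y (m + n))" if "j \<le> m + n" for j
      by (rule measurable_compose[OF Yh[OF that]]) measurable
    have "(\<lambda>\<omega>. w (Y m \<omega>)) \<in> borel_measurable (chain_history M S Y (m + n))"
      by (rule measurable_compose[OF Yh w]) simp
    then show ?thesis
      unfolding V_def by (intro borel_measurable_times borel_measurable_prod g) auto
  qed
  have "(\<integral>\<^sup>+\<omega>. ennreal (w (Y m \<omega>) * (\<Prod>j\<in>{m..<m+Suc n}. damping (Y j \<omega>))) * ennreal (mass k (Y (m + Suc n) \<omega>)) \<partial>M)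
      = (\<integral>\<^sup>+\<omega>. ennreal (V \<omega> * damping (Y (m + n) \<omega>)) * ennreal (mass k (Y (Suc (m + n)) \<omega>)) \<partial>M)"
    by (simp add: V_def mult.assoc del: times_divide_eq_left times_divide_eq_right)
  also have "\<dots> = (\<integral>\<^sup>+\<omega>. ennreal (V \<omega> * damping (Y (m + n) \<omega>)) * (\<integral>\<^sup>+y. ennreal (mass k y) \<partial>p (Y (m + n) \<omega>)) \<partial>M)"
  proof (rule markov_property_nn_integral[OF M kernel Y U])
    fix \<omega> assume \<omega>: "\<omega> \<in> space M"
    show "0 \<le> V \<omega> * damping (Y (m + n) \<omega>) \<and> V \<omega> * damping (Y (m + n) \<omega>) \<le> 1"
      using damping_bounds[OF Y_space[OF \<omega>, of "m + n"]] prod01[OF \<omega>, of "{m..<m+n}"] w01[of "Y m \<omega>"]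
      unfolding V_def
      by (intro conjI mult_nonneg_nonneg mult_le_one) auto
  qed measurable
  also have "\<dots> = (\<integral>\<^sup>+\<omega>. ennreal (V \<omega>) * ennreal (mass (Suc k) (Y (m + n) \<omega>)) \<partial>M)"
  proof (intro nn_integral_cong)
    fix \<omega> assume \<omega>: "\<omega> \<in> space M"
    have "0 \<le> V \<omega>" using prod01[OF \<omega>] w01 by (auto simp: V_def)
    then show "ennreal (V \<omega> * damping (Y (m + n) \<omega>)) * (\<integral>\<^sup>+y. ennreal (mass k y) \<partial>p (Y (m + n) \<omega>))
        = ennreal (V \<omega>) * ennreal (mass (Suc k) (Y (m + n) \<omega>))"
      unfolding ennreal_damped_mass_Suc[OF Y_space[OF \<omega>]]
      by (simp add: ennreal_mult' mult.assoc del: times_divide_eq_left times_divide_eq_right)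
  qed
  also have "\<dots> = (\<integral>\<^sup>+\<omega>. ennreal (w (Y m \<omega>) * mass (n + Suc k) (Y m \<omega>)) \<partial>M)"
    unfolding V_def by (rule Suc)
  finally show ?case by simp
qed

end

section \<open>Level sums of a cascade\<close>

lemma path_vertex_through:
  "j \<le> length v \<Longrightarrow> path_vertex (\<lambda>i. i < length v \<and> v ! i) j = take j v"
  unfolding path_vertex_def by (rule nth_equalityI) auto

context dsy_cascade_type_M
begin

lemma state_measurable [measurable]: "X v \<in> measurable M S"
  using markov_along_paths[of "\<lambda>i. i < length v \<and> v ! i"] path_vertex_through[of "length v" v]
  unfolding markov_chain_def by (metis order_refl take_all)

text \<open>
  The states at level \<open>m\<close> share the law \<open>\<mu>\<close>, under which \<open>total_mass\<close> is finite almost surely but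
  perhaps not integrable.  Weighting each branch by \<open>w = 1 / (1 + total_mass)\<close>, evaluated at its
  level-\<open>m\<close> vertex, makes the expected sum over all later vertices at most \<open>2 ^ m\<close>.  The weighted
  sum of vertex weights is thus almost surely finite, and since the finitely many values of \<open>w\<close> on
  level \<open>m\<close> are positive, the level sums themselves tend to \<open>0\<close>.

  No joint law of different branches enters, because the bound is linear in the branches.
\<close>

theorem level_weights_vanish:
  assumes a: "0 < a"
    and law: "\<And>u. length u = m \<Longrightarrow> distr M S (X u) = \<mu>"
    and fin: "AE y in \<mu>. (\<Sum>n. ennreal (2 ^ n * damped_mass lam p a n y)) < \<infinity>"
  shows "AE \<omega> in M. (\<lambda>n. \<Sum>v | length v = n. vertex_weight a (\<lambda>u. lam (X u \<omega>)) v) \<longlonglongrightarrow> 0"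
proof -
  interpret K: damped_kernel S lam p a
    by unfold_locales (fact intensity_measurable intensity_positive kernel a)+
  define w where "w y = (if K.total_mass y = \<infinity> then 0 else 1 / (1 + enn2real (K.total_mass y)))" for y
  have w01: "0 \<le> w y \<and> w y \<le> 1" for y
    by (simp add: w_def divide_le_eq add_pos_nonneg)
  have w_pos: "0 < w y" if "K.total_mass y < \<infinity>" for y
    using that by (simp add: w_def add_pos_nonneg)
  have [measurable]: "w \<in> borel_measurable S"
    unfolding w_def by measurable
  have w_mult: "ennreal (w y) * K.total_mass y \<le> 1" for y
    by (cases "K.total_mass y") (auto simp: w_def ennreal_mult[symmetric] simp flip: ennreal_1)
  have X_space: "X v \<omega> \<in> space S" if "\<omega> \<in> space M" for v \<omega>
    using measurable_space[OF state_measurable that] .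
  define u0 where "u0 = replicate m True"
  have u0: "\<mu> = distr M S (X u0)" using law[of u0] by (simp add: u0_def)
  interpret \<mu>: prob_space \<mu>
    unfolding u0 by (rule prob_space_distr) measurable
  have s\<mu> [measurable_cong]: "sets \<mu> = sets S" by (simp add: u0)
  have sp\<mu>: "space \<mu> = space S" by (simp add: u0)
  define q where "q v \<omega> = vertex_weight a (\<lambda>u. lam (X u \<omega>)) v" for v \<omega>
  have [measurable]: "q v \<in> borel_measurable M" for v
    unfolding q_def vertex_weight_def using intensity_measurable by measurable
  have q_nonneg: "0 \<le> q v \<omega>" if "\<omega> \<in> space M" for v \<omega>
    unfolding q_def vertex_weight_def
    using K.damping_bounds[OF X_space[OF that]] by (intro prod_nonneg) (simp add: less_imp_le)
  \<comment> \<open>Factors \<open>lam / (a + lam) \<le> 1\<close> before level \<open>m\<close> and at the final vertex are dropped.\<close>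
  have branch: "(\<integral>\<^sup>+\<omega>. ennreal (w (X (take m v) \<omega>) * q v \<omega>) \<partial>M) \<le> (\<integral>\<^sup>+y. ennreal (w y * K.mass n y) \<partial>\<mu>)"
    if v: "length v = m + n" for v n
  proof -
    define s where "s = (\<lambda>i. i < length v \<and> v ! i)"
    have path: "path_vertex s j = take j v" if "j \<le> m + n" for j
      unfolding s_def using that v by (intro path_vertex_through) simp
    have q_le: "q v \<omega> \<le> (\<Prod>j\<in>{m..<m+n}. K.damping (X (take j v) \<omega>))" if \<omega>: "\<omega> \<in> space M" for \<omega>
    proof -
      note b = K.damping_bounds[OF X_space[OF \<omega>]]
      have "q v \<omega> = (\<Prod>j\<in>{..m+n} - {m..<m+n}. K.damping (X (take j v) \<omega>)) * (\<Prod>j\<in>{m..<m+n}. K.damping (X (take j v) \<omega>))"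
        unfolding q_def vertex_weight_def v by (rule prod.subset_diff) auto
      also have "\<dots> \<le> 1 * (\<Prod>j\<in>{m..<m+n}. K.damping (X (take j v) \<omega>))"
        using b by (intro mult_right_mono prod_le_1 prod_nonneg) (auto simp: less_imp_le simp del: times_divide_eq_left)
      finally show ?thesis by simp
    qed
    have "(\<integral>\<^sup>+\<omega>. ennreal (w (X (take m v) \<omega>) * q v \<omega>) \<partial>M)
        \<le> (\<integral>\<^sup>+\<omega>. ennreal (w (X (path_vertex s m) \<omega>) * (\<Prod>j\<in>{m..<m+n}. K.damping (X (path_vertex s j) \<omega>)))
              * ennreal (K.mass 0 (X (path_vertex s (m + n)) \<omega>)) \<partial>M)"
      using q_le w01 by (intro nn_integral_mono) (auto simp: path intro!: ennreal_leI mult_left_mono)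
    also have "\<dots> = (\<integral>\<^sup>+\<omega>. ennreal (w (X (path_vertex s m) \<omega>) * K.mass (n + 0) (X (path_vertex s m) \<omega>)) \<partial>M)"
      by (rule K.chain_damping[OF prob_space_axioms markov_along_paths _ w01]) measurable
    also have "\<dots> = (\<integral>\<^sup>+y. ennreal (w y * K.mass n y) \<partial>distr M S (X (take m v)))"
      by (subst nn_integral_distr) (auto simp: path)
    finally show ?thesis using law[of "take m v"] v by simp
  qed
  have "(\<integral>\<^sup>+\<omega>. (\<Sum>n. \<Sum>v | length v = m + n. ennreal (w (X (take m v) \<omega>) * q v \<omega>)) \<partial>M)
      = (\<Sum>n. \<Sum>v | length v = m + n. \<integral>\<^sup>+\<omega>. ennreal (w (X (take m v) \<omega>) * q v \<omega>) \<partial>M)"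
    by (subst nn_integral_suminf, measurable, subst nn_integral_sum, measurable)
  also have "\<dots> \<le> (\<Sum>n. \<Sum>v :: vertex | length v = m + n. \<integral>\<^sup>+y. ennreal (w y * K.mass n y) \<partial>\<mu>)"
  proof (rule suminf_le)
    fix n
    show "(\<Sum>v | length v = m + n. \<integral>\<^sup>+\<omega>. ennreal (w (X (take m v) \<omega>) * q v \<omega>) \<partial>M)
        \<le> (\<Sum>v :: vertex | length v = m + n. \<integral>\<^sup>+y. ennreal (w y * K.mass n y) \<partial>\<mu>)"
      by (rule sum_mono) (simp add: branch)
  qed auto
  also have "\<dots> = (\<Sum>n. \<integral>\<^sup>+y. 2 ^ m * (ennreal (w y) * ennreal (2 ^ n * K.mass n y)) \<partial>\<mu>)"
  proof (intro suminf_cong)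
    fix n
    have "(\<Sum>v :: vertex | length v = m + n. \<integral>\<^sup>+y. ennreal (w y * K.mass n y) \<partial>\<mu>)
        = (\<integral>\<^sup>+y. 2 ^ (m + n) * ennreal (w y * K.mass n y) \<partial>\<mu>)"
      by (subst nn_integral_cmult) (auto simp: card_level)
    also have "\<dots> = (\<integral>\<^sup>+y. 2 ^ m * (ennreal (w y) * ennreal (2 ^ n * K.mass n y)) \<partial>\<mu>)"
      using w01
      by (intro nn_integral_cong)
         (simp add: ennreal_mult' power_add ennreal_power[symmetric] mult_ac)
    finally show "(\<Sum>v :: vertex | length v = m + n. \<integral>\<^sup>+y. ennreal (w y * K.mass n y) \<partial>\<mu>)
        = (\<integral>\<^sup>+y. 2 ^ m * (ennreal (w y) * ennreal (2 ^ n * K.mass n y)) \<partial>\<mu>)" .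
  qed
  also have "\<dots> = (\<integral>\<^sup>+y. 2 ^ m * (ennreal (w y) * K.total_mass y) \<partial>\<mu>)"
    unfolding K.total_mass_def by (subst nn_integral_suminf[symmetric]) (auto simp: ennreal_suminf_cmult)
  also have "\<dots> \<le> (\<integral>\<^sup>+y. 2 ^ m \<partial>\<mu>)"
    using mult_left_mono[OF w_mult] by (intro nn_integral_mono) fastforce
  also have "\<dots> < \<infinity>"
    by (simp add: \<mu>.emeasure_space_1 power_less_top_ennreal)
  finally have "AE \<omega> in M. (\<Sum>n. \<Sum>v | length v = m + n. ennreal (w (X (take m v) \<omega>) * q v \<omega>)) \<noteq> \<infinity>"
    by (intro nn_integral_noteq_infinite) auto
  moreover have "AE \<omega> in M. \<forall>u\<in>{u. length u = m}. 0 < w (X u \<omega>)"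
  proof (subst AE_ball_countable)
    show "countable {u :: vertex. length u = m}" by (rule countable_finite[OF finite_level])
    have "AE y in \<mu>. 0 < w y"
      using fin unfolding K.total_mass_def[symmetric] by eventually_elim (rule w_pos)
    have "AE y in distr M S (X u). 0 < w y" if "length u = m" for u
      unfolding law[OF that] using \<open>AE y in \<mu>. 0 < w y\<close> .
    then show "\<forall>u\<in>{u. length u = m}. AE \<omega> in M. 0 < w (X u \<omega>)"
      by (simp add: AE_distr_iff)
  qed
  ultimately show ?thesis
    using AE_space
  proof eventually_elim
    case (elim \<omega>)
    define c where "c = Min ((\<lambda>u. w (X u \<omega>)) ` {u. length u = m})"
    have fin_im: "finite ((\<lambda>u. w (X u \<omega>)) ` {u. length u = m})"
      by (intro finite_imageI finite_level)
    have c: "0 < c"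
      unfolding c_def using elim(2) level_nonempty[of m] by (subst Min_gr_iff[OF fin_im]) auto
    define z where "z n = (\<Sum>v | length v = n. q v \<omega>)" for n
    have z: "0 \<le> z n" for n
      unfolding z_def using q_nonneg[OF elim(3)] by (intro sum_nonneg) auto
    have "ennreal (c * z (n + m)) \<le> (\<Sum>v | length v = m + n. ennreal (w (X (take m v) \<omega>) * q v \<omega>))" for n
    proof -
      have "c * z (n + m) \<le> (\<Sum>v | length v = m + n. w (X (take m v) \<omega>) * q v \<omega>)"
        unfolding z_def sum_distrib_left add.commute[of n]
        using q_nonneg[OF elim(3)]
        by (intro sum_mono mult_right_mono) (auto simp: c_def intro!: Min_le fin_im)
      then show ?thesis
        using q_nonneg[OF elim(3)] w01 by (subst sum_ennreal) (auto intro!: ennreal_leI)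
    qed
    then have "(\<Sum>n. ennreal (c * z (n + m))) \<le> (\<Sum>n. \<Sum>v | length v = m + n. ennreal (w (X (take m v) \<omega>) * q v \<omega>))"
      by (intro suminf_le) auto
    then have "(\<Sum>n. ennreal (c * z (n + m))) \<noteq> top"
      using elim(1) by (auto simp: top_unique)
    then have "summable (\<lambda>n. c * z (n + m))"
      using c z by (intro summable_suminf_not_top) auto
    then have "(\<lambda>n. c * z (n + m)) \<longlonglongrightarrow> 0"
      by (rule summable_LIMSEQ_zero)
    from tendsto_mult[OF tendsto_const this, of "inverse c"] have "(\<lambda>n. z (n + m)) \<longlonglongrightarrow> 0"
      using c by simp
    then have "z \<longlonglongrightarrow> 0"
      by (rule LIMSEQ_offset)
    then show ?case unfolding z_def q_def .
  qed
qed

end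

section \<open>Square-integrable functions\<close>

lemma L2_spaceD:
  assumes "f \<in> L2_space \<gamma>"
  shows "f \<in> borel_measurable \<gamma>" and "integrable \<gamma> (\<lambda>x. (cmod (f x))\<^sup>2)"
  using assms by (auto simp: L2_space_def)

lemma L2_norm_nonneg: "0 \<le> L2_norm \<gamma> f"
  by (simp add: L2_norm_def)

lemma L2_norm_square: "(L2_norm \<gamma> f)\<^sup>2 = (LINT x|\<gamma>. (cmod (f x))\<^sup>2)"
  by (simp add: L2_norm_def)

lemma L2_space_cmult: "f \<in> L2_space \<gamma> \<Longrightarrow> (\<lambda>x. c * f x) \<in> L2_space \<gamma>"
  by (auto simp: L2_space_def norm_mult power_mult_distrib)

lemma L2_norm_cmult: "L2_norm \<gamma> (\<lambda>x. c * f x) = cmod c * L2_norm \<gamma> f"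
  by (simp add: L2_norm_def norm_mult power_mult_distrib real_sqrt_mult)

lemma cmod_add_square_le: "(cmod (a + b))\<^sup>2 \<le> 2 * (cmod a)\<^sup>2 + 2 * (cmod b)\<^sup>2"
proof -
  have "(cmod (a + b))\<^sup>2 \<le> (cmod a + cmod b)\<^sup>2"
    by (intro power_mono norm_triangle_ineq) simp
  also have "\<dots> \<le> 2 * (cmod a)\<^sup>2 + 2 * (cmod b)\<^sup>2"
    using sum_squares_ge_zero[of "cmod a - cmod b" 0] by (simp add: power2_eq_square algebra_simps)
  finally show ?thesis .
qed

lemma L2_space_add:
  assumes f: "f \<in> L2_space \<gamma>" and g: "g \<in> L2_space \<gamma>"
  shows "(\<lambda>x. f x + g x) \<in> L2_space \<gamma>"
proof -
  note [measurable] = L2_spaceD(1)[OF f] L2_spaceD(1)[OF g]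
  have "integrable \<gamma> (\<lambda>x. (cmod (f x + g x))\<^sup>2)"
    by (rule Bochner_Integration.integrable_bound[where f = "\<lambda>x. 2 * (cmod (f x))\<^sup>2 + 2 * (cmod (g x))\<^sup>2"])
       (use L2_spaceD(2)[OF f] L2_spaceD(2)[OF g] cmod_add_square_le in auto)
  then show ?thesis by (simp add: L2_space_def)
qed

lemma L2_space_diff:
  assumes "f \<in> L2_space \<gamma>" and "g \<in> L2_space \<gamma>"
  shows "(\<lambda>x. f x - g x) \<in> L2_space \<gamma>"
  using L2_space_add[OF assms(1) L2_space_cmult[OF assms(2), of "-1"]] by simp

text \<open>
  The elementary substitute for the triangle inequality; the constant \<open>2\<close> is harmless for the local
  bound on resolvents below.
\<close>
lemma L2_norm_square_add_le:
  assumes f: "f \<in> L2_space \<gamma>" and g: "g \<in> L2_space \<gamma>"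
    and u: "AE x in \<gamma>. u x = f x + g x" and [measurable]: "u \<in> borel_measurable \<gamma>"
  shows "(L2_norm \<gamma> u)\<^sup>2 \<le> 2 * (L2_norm \<gamma> f)\<^sup>2 + 2 * (L2_norm \<gamma> g)\<^sup>2"
proof -
  note [measurable] = L2_spaceD(1)[OF f] L2_spaceD(1)[OF g]
  have "(LINT x|\<gamma>. (cmod (u x))\<^sup>2) = (LINT x|\<gamma>. (cmod (f x + g x))\<^sup>2)"
    using u by (intro integral_cong_AE) auto
  also have "\<dots> \<le> (LINT x|\<gamma>. 2 * (cmod (f x))\<^sup>2 + 2 * (cmod (g x))\<^sup>2)"
    using L2_spaceD(2)[OF L2_space_add[OF f g]] L2_spaceD(2)[OF f] L2_spaceD(2)[OF g]
    by (intro integral_mono cmod_add_square_le) auto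
  finally show ?thesis
    using L2_spaceD(2)[OF f] L2_spaceD(2)[OF g] by (simp add: L2_norm_square)
qed

lemma L2_norm_eq_0_iff_AE:
  assumes "f \<in> L2_space \<gamma>"
  shows "L2_norm \<gamma> f = 0 \<longleftrightarrow> (AE x in \<gamma>. f x = 0)"
  using integral_nonneg_eq_0_iff_AE[OF L2_spaceD(2)[OF assms]] by (simp add: L2_norm_def)

lemma L2_integral_bound:
  assumes "prob_space \<gamma>" and f: "f \<in> L2_space \<gamma>"
  shows "integrable \<gamma> f" and "cmod (LINT x|\<gamma>. f x) \<le> L2_norm \<gamma> f"
proof -
  interpret prob_space \<gamma> by fact
  note [measurable] = L2_spaceD(1)[OF f]
  have int: "integrable \<gamma> (\<lambda>x. cmod (f x))"
    by (rule square_integrable_imp_integrable[OF _ L2_spaceD(2)[OF f]]) simp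
  then show "integrable \<gamma> f"
    by (simp add: integrable_norm_iff)
  have "(LINT x|\<gamma>. cmod (f x))\<^sup>2 \<le> (L2_norm \<gamma> f)\<^sup>2"
    using variance_positive[of "\<lambda>x. cmod (f x)"] variance_eq[OF int L2_spaceD(2)[OF f]]
    by (simp add: L2_norm_square)
  then have "(LINT x|\<gamma>. cmod (f x)) \<le> L2_norm \<gamma> f"
    by (rule power2_le_imp_le[OF _ L2_norm_nonneg])
  then show "cmod (LINT x|\<gamma>. f x) \<le> L2_norm \<gamma> f"
    using integral_norm_bound[of \<gamma> f] by linarith
qed

section \<open>Resolvents and iterates of a bounded operator\<close>

lemma L2_bounded_operatorD:
  assumes "L2_bounded_operator \<gamma> A"
  shows "f \<in> L2_space \<gamma> \<Longrightarrow> A f \<in> L2_space \<gamma>"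
    and "f \<in> L2_space \<gamma> \<Longrightarrow> g \<in> L2_space \<gamma> \<Longrightarrow> AE x in \<gamma>. A (\<lambda>y. f y + g y) x = A f x + A g x"
    and "f \<in> L2_space \<gamma> \<Longrightarrow> AE x in \<gamma>. A (\<lambda>y. c * f y) x = c * A f x"
  using assms by (simp_all add: L2_bounded_operator_def)

lemma L2_bounded_operator_bound:
  assumes "L2_bounded_operator \<gamma> A"
  shows "\<exists>C\<ge>1. \<forall>f\<in>L2_space \<gamma>. L2_norm \<gamma> (A f) \<le> C * L2_norm \<gamma> f"
proof -
  obtain C where C: "\<And>f. f \<in> L2_space \<gamma> \<Longrightarrow> L2_norm \<gamma> (A f) \<le> C * L2_norm \<gamma> f"
    using assms unfolding L2_bounded_operator_def by blast
  have "L2_norm \<gamma> (A f) \<le> max C 1 * L2_norm \<gamma> f" if "f \<in> L2_space \<gamma>" for f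
    using C[OF that] mult_right_mono[of C "max C 1" "L2_norm \<gamma> f"] L2_norm_nonneg[of \<gamma> f]
    by simp
  then show ?thesis by (intro exI[of _ "max C 1"]) simp
qed

lemma L2_bounded_operator_diff:
  assumes A: "L2_bounded_operator \<gamma> A" and f: "f \<in> L2_space \<gamma>" and g: "g \<in> L2_space \<gamma>"
  shows "AE x in \<gamma>. A (\<lambda>y. f y - g y) x = A f x - A g x"
proof -
  have "AE x in \<gamma>. A (\<lambda>y. f y + (-1) * g y) x = A f x + A (\<lambda>y. (-1) * g y) x"
    by (rule L2_bounded_operatorD(2)[OF A f L2_space_cmult[OF g]])
  moreover have "AE x in \<gamma>. A (\<lambda>y. (-1) * g y) x = (-1) * A g x"
    by (rule L2_bounded_operatorD(3)[OF A g])
  ultimately show ?thesis by eventually_elim simp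
qed

lemma L2_bounded_operator_cong_AE:
  assumes A: "L2_bounded_operator \<gamma> A" and f: "f \<in> L2_space \<gamma>" and g: "g \<in> L2_space \<gamma>"
    and eq: "AE x in \<gamma>. f x = g x"
  shows "AE x in \<gamma>. A f x = A g x"
proof -
  obtain C where "1 \<le> C" and C: "\<And>f. f \<in> L2_space \<gamma> \<Longrightarrow> L2_norm \<gamma> (A f) \<le> C * L2_norm \<gamma> f"
    using L2_bounded_operator_bound[OF A] by blast
  note fg = L2_space_diff[OF f g]
  have "L2_norm \<gamma> (\<lambda>y. f y - g y) = 0"
    using eq by (subst L2_norm_eq_0_iff_AE[OF fg]) (auto elim: eventually_mono)
  then have "L2_norm \<gamma> (A (\<lambda>y. f y - g y)) = 0"
    using C[OF fg] L2_norm_nonneg[of \<gamma> "A (\<lambda>y. f y - g y)"] by simp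
  then have "AE x in \<gamma>. A (\<lambda>y. f y - g y) x = 0"
    using L2_norm_eq_0_iff_AE[OF L2_bounded_operatorD(1)[OF A fg]] by simp
  then show ?thesis
    using L2_bounded_operator_diff[OF A f g] by eventually_elim simp
qed

definition resolvent_at ::
    "'s measure \<Rightarrow> (('s \<Rightarrow> complex) \<Rightarrow> 's \<Rightarrow> complex) \<Rightarrow> complex \<Rightarrow> (('s \<Rightarrow> complex) \<Rightarrow> 's \<Rightarrow> complex) \<Rightarrow> bool" where
  "resolvent_at \<gamma> A z R \<longleftrightarrow> L2_bounded_operator \<gamma> R \<and>
     (\<forall>f\<in>L2_space \<gamma>. AE x in \<gamma>. R (\<lambda>y. z * f y - A f y) x = f x) \<and>
     (\<forall>f\<in>L2_space \<gamma>. AE x in \<gamma>. z * R f x - A (R f) x = f x)"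

lemma L2_resolvent_set_iff: "z \<in> L2_resolvent_set \<gamma> A \<longleftrightarrow> (\<exists>R. resolvent_at \<gamma> A z R)"
  by (simp add: L2_resolvent_set_def resolvent_at_def)

lemma resolvent_atD:
  assumes "resolvent_at \<gamma> A z R"
  shows "L2_bounded_operator \<gamma> R"
    and "f \<in> L2_space \<gamma> \<Longrightarrow> AE x in \<gamma>. R (\<lambda>y. z * f y - A f y) x = f x"
    and "f \<in> L2_space \<gamma> \<Longrightarrow> AE x in \<gamma>. z * R f x - A (R f) x = f x"
  using assms by (simp_all add: resolvent_at_def)

text \<open>
  \<open>Rz f - Rw f\<close> solves \<open>(w - A) D = (w - z) Rz f\<close>, to which \<open>Rw\<close> is applied.
\<close>
lemma resolvent_identity:
  assumes A: "L2_bounded_operator \<gamma> A" and Rz: "resolvent_at \<gamma> A z Rz" and Rw: "resolvent_at \<gamma> A w Rw"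
    and f: "f \<in> L2_space \<gamma>"
  shows "AE x in \<gamma>. Rz f x - Rw f x = (w - z) * Rw (Rz f) x"
proof -
  note bz = resolvent_atD(1)[OF Rz] and bw = resolvent_atD(1)[OF Rw]
  have z: "Rz f \<in> L2_space \<gamma>" and w: "Rw f \<in> L2_space \<gamma>"
    by (auto intro: L2_bounded_operatorD(1)[OF bz f] L2_bounded_operatorD(1)[OF bw f])
  define D where "D = (\<lambda>x. Rz f x - Rw f x)"
  have D: "D \<in> L2_space \<gamma>" unfolding D_def by (rule L2_space_diff[OF z w])
  have "AE x in \<gamma>. A D x = A (Rz f) x - A (Rw f) x"
    unfolding D_def by (rule L2_bounded_operator_diff[OF A z w])
  then have "AE x in \<gamma>. w * D x - A D x = (w - z) * Rz f x"
    using resolvent_atD(3)[OF Rz f] resolvent_atD(3)[OF Rw f]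
  proof eventually_elim
    case (elim x)
    then show ?case
      unfolding elim(1) D_def by algebra
  qed
  then have "AE x in \<gamma>. Rw (\<lambda>x. w * D x - A D x) x = Rw (\<lambda>x. (w - z) * Rz f x) x"
    by (intro L2_bounded_operator_cong_AE[OF bw] L2_space_diff L2_space_cmult
          L2_bounded_operatorD(1)[OF A] D z)
  moreover have "AE x in \<gamma>. Rw (\<lambda>x. w * D x - A D x) x = D x"
    by (rule resolvent_atD(2)[OF Rw D])
  moreover have "AE x in \<gamma>. Rw (\<lambda>x. (w - z) * Rz f x) x = (w - z) * Rw (Rz f) x"
    by (rule L2_bounded_operatorD(3)[OF bw z])
  ultimately show ?thesis
    by eventually_elim (simp add: D_def)
qed

text \<open>
  In the resolvent identity the correction term has norm at most half of the left-hand side once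
  \<open>z\<close> is close to \<open>w\<close>, and is absorbed there.  The bound uses only a constant for \<open>Rw\<close>, which
  makes it uniform in \<open>z\<close>.
\<close>
lemma resolvent_bound_nearby:
  assumes A: "L2_bounded_operator \<gamma> A" and Rz: "resolvent_at \<gamma> A z Rz" and Rw: "resolvent_at \<gamma> A w Rw"
    and C: "\<And>f. f \<in> L2_space \<gamma> \<Longrightarrow> L2_norm \<gamma> (Rw f) \<le> C * L2_norm \<gamma> f"
    and near: "cmod (w - z) * C \<le> 1 / 2"
    and f: "f \<in> L2_space \<gamma>"
  shows "L2_norm \<gamma> (Rz f) \<le> 2 * L2_norm \<gamma> (Rw f)"
proof -
  note bz = resolvent_atD(1)[OF Rz] and bw = resolvent_atD(1)[OF Rw]
  have z: "Rz f \<in> L2_space \<gamma>" and w: "Rw f \<in> L2_space \<gamma>" and wz: "Rw (Rz f) \<in> L2_space \<gamma>"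
    by (auto intro!: L2_bounded_operatorD(1)[OF bz] L2_bounded_operatorD(1)[OF bw] f)
  define N where "N = L2_norm \<gamma> (Rz f)"
  have "(L2_norm \<gamma> (Rz f))\<^sup>2 \<le> 2 * (L2_norm \<gamma> (Rw f))\<^sup>2 + 2 * (L2_norm \<gamma> (\<lambda>x. (w - z) * Rw (Rz f) x))\<^sup>2"
  proof (rule L2_norm_square_add_le[OF w L2_space_cmult[OF wz] _ L2_spaceD(1)[OF z]])
    show "AE x in \<gamma>. Rz f x = Rw f x + (w - z) * Rw (Rz f) x"
      using resolvent_identity[OF A Rz Rw f] by eventually_elim (simp add: algebra_simps)
  qed
  moreover have "L2_norm \<gamma> (\<lambda>x. (w - z) * Rw (Rz f) x) \<le> N / 2"
  proof -
    have "L2_norm \<gamma> (\<lambda>x. (w - z) * Rw (Rz f) x) \<le> cmod (w - z) * (C * N)"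
      unfolding L2_norm_cmult N_def by (intro mult_left_mono C z) simp
    also have "\<dots> = (cmod (w - z) * C) * N" by simp
    also have "\<dots> \<le> 1 / 2 * N"
      using near by (intro mult_right_mono) (auto simp: N_def L2_norm_nonneg)
    finally show ?thesis by simp
  qed
  then have "(L2_norm \<gamma> (\<lambda>x. (w - z) * Rw (Rz f) x))\<^sup>2 \<le> (N / 2)\<^sup>2"
    by (intro power_mono L2_norm_nonneg)
  ultimately have "N\<^sup>2 \<le> (2 * L2_norm \<gamma> (Rw f))\<^sup>2"
    by (simp add: N_def power_mult_distrib power_divide)
  then show ?thesis
    unfolding N_def by (rule power2_le_imp_le) (simp add: L2_norm_nonneg)
qed

text \<open>
  Analyticity of the resolvent is needed only after integration against \<open>\<gamma>\<close>, that is for a single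
  scalar function.  By the resolvent identity the difference quotient is the integral of
  \<open>- R z (R w f)\<close>; a second use of the identity, with the uniform bound nearby, gives its limit.
\<close>

lemma resolvent_integral_has_derivative:
  assumes \<gamma>: "prob_space \<gamma>" and A: "L2_bounded_operator \<gamma> A"
    and U: "open U" "w \<in> U" and R: "\<And>z. z \<in> U \<Longrightarrow> resolvent_at \<gamma> A z (R z)"
    and f: "f \<in> L2_space \<gamma>"
  shows "((\<lambda>z. LINT x|\<gamma>. R z f x) has_field_derivative - (LINT x|\<gamma>. R w (R w f) x)) (at w)"
proof -
  define \<psi> where "\<psi> f z = (LINT x|\<gamma>. R z f x)" for f z
  have L2: "R z f \<in> L2_space \<gamma>" if "z \<in> U" "f \<in> L2_space \<gamma>" for z f
    by (rule L2_bounded_operatorD(1)[OF resolvent_atD(1)[OF R[OF that(1)]] that(2)])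
  have diff: "\<psi> f z - \<psi> f v = (v - z) * \<psi> (R z f) v"
    if z: "z \<in> U" and v: "v \<in> U" and f: "f \<in> L2_space \<gamma>" for f z v
  proof -
    note int = L2_integral_bound(1)[OF \<gamma> L2[OF _ f]]
    have "\<psi> f z - \<psi> f v = (LINT x|\<gamma>. R z f x - R v f x)"
      unfolding \<psi>_def by (rule Bochner_Integration.integral_diff[OF int[OF z] int[OF v], symmetric])
    also have "\<dots> = (LINT x|\<gamma>. (v - z) * R v (R z f) x)"
      using resolvent_identity[OF A R[OF z] R[OF v] f]
        L2_spaceD(1)[OF L2[OF z f]] L2_spaceD(1)[OF L2[OF v f]] L2_spaceD(1)[OF L2[OF v L2[OF z f]]]
      by (intro integral_cong_AE) auto
    finally show ?thesis by (simp add: \<psi>_def)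
  qed
  obtain C where C1: "1 \<le> C" and C: "\<And>f. f \<in> L2_space \<gamma> \<Longrightarrow> L2_norm \<gamma> (R w f) \<le> C * L2_norm \<gamma> f"
    using L2_bounded_operator_bound[OF resolvent_atD(1)[OF R[OF U(2)]]] by blast
  define v where "v = R w f"
  have v: "v \<in> L2_space \<gamma>" unfolding v_def by (rule L2[OF U(2) f])
  define K where "K = C * (2 * L2_norm \<gamma> (R w v))"
  obtain d where d: "0 < d" "ball w d \<subseteq> U"
    using U open_contains_ball by blast
  define d' where "d' = min d (1 / (2 * C))"
  have d': "0 < d'" using d C1 by (simp add: d'_def)
  have "norm ((\<psi> f z - \<psi> f w) / (z - w) - (- \<psi> v w)) \<le> K * cmod (z - w)"
    if z: "z \<noteq> w" "dist z w < d'" for z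
  proof -
    have zU: "z \<in> U" using z d by (auto simp: d'_def dist_commute)
    have "cmod (w - z) * C \<le> 1 / (2 * C) * C"
      using z C1 by (intro mult_right_mono) (auto simp: d'_def dist_norm norm_minus_commute)
    then have near: "cmod (w - z) * C \<le> 1 / 2" using C1 by simp
    have "\<psi> f w - \<psi> f z = (z - w) * \<psi> v z"
      unfolding v_def by (rule diff[OF U(2) zU f])
    then have "(\<psi> f z - \<psi> f w) / (z - w) = - \<psi> v z"
      using z by (simp add: field_simps)
    then have "(\<psi> f z - \<psi> f w) / (z - w) - (- \<psi> v w) = - (\<psi> v z - \<psi> v w)"
      by simp
    also have "\<psi> v z - \<psi> v w = (w - z) * \<psi> (R z v) w"
      by (rule diff[OF zU U(2) v])
    finally have eq: "norm ((\<psi> f z - \<psi> f w) / (z - w) - (- \<psi> v w)) = cmod (z - w) * cmod (\<psi> (R z v) w)"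
      by (simp add: norm_mult norm_minus_commute)
    have "cmod (\<psi> (R z v) w) \<le> K"
    proof -
      have "cmod (\<psi> (R z v) w) \<le> L2_norm \<gamma> (R w (R z v))"
        unfolding \<psi>_def by (intro L2_integral_bound(2)[OF \<gamma>] L2 U zU v)
      also have "\<dots> \<le> C * L2_norm \<gamma> (R z v)"
        by (intro C L2 zU v)
      also have "\<dots> \<le> K"
        unfolding K_def using C1
        by (intro mult_left_mono resolvent_bound_nearby[OF A R[OF zU] R[OF U(2)] C near v]) auto
      finally show ?thesis .
    qed
    then show ?thesis
      unfolding eq mult.commute[of K] by (rule mult_left_mono) simp
  qed
  then have "eventually (\<lambda>z. norm ((\<psi> f z - \<psi> f w) / (z - w) - (- \<psi> v w)) \<le> K * cmod (z - w)) (at w)"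
    using d' unfolding eventually_at by blast
  moreover have "((\<lambda>z. K * cmod (z - w)) \<longlongrightarrow> 0) (at w)"
    by (auto intro!: tendsto_eq_intros)
  ultimately have "((\<lambda>z. (\<psi> f z - \<psi> f w) / (z - w) - (- \<psi> v w)) \<longlongrightarrow> 0) (at w)"
    by (rule Lim_null_comparison)
  then have "((\<lambda>z. (\<psi> f z - \<psi> f w) / (z - w)) \<longlongrightarrow> - \<psi> v w) (at w)"
    by (rule LIM_zero_cancel)
  then show ?thesis
    unfolding has_field_derivative_iff \<psi>_def v_def .
qed

lemma iterate_L2:
  assumes "L2_bounded_operator \<gamma> A" and "f \<in> L2_space \<gamma>"
  shows "(A ^^ n) f \<in> L2_space \<gamma>"
  using assms by (induction n) (auto intro: L2_bounded_operatorD(1))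

lemma iterate_L2_norm_le:
  assumes A: "L2_bounded_operator \<gamma> A" and C: "1 \<le> C" "\<And>f. f \<in> L2_space \<gamma> \<Longrightarrow> L2_norm \<gamma> (A f) \<le> C * L2_norm \<gamma> f"
    and f: "f \<in> L2_space \<gamma>"
  shows "L2_norm \<gamma> ((A ^^ n) f) \<le> C ^ n * L2_norm \<gamma> f"
proof (induction n)
  case (Suc n)
  have "L2_norm \<gamma> ((A ^^ Suc n) f) \<le> C * L2_norm \<gamma> ((A ^^ n) f)"
    by (simp add: C(2) iterate_L2[OF A f])
  also have "\<dots> \<le> C * (C ^ n * L2_norm \<gamma> f)"
    using C(1) by (intro mult_left_mono Suc) simp
  finally show ?case by simp
qed simp

text \<open>
  The Neumann series for large \<open>z\<close>, after integration.  It follows from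
  \<open>z R (A^n f) = A^n f + R (A^(n+1) f)\<close>, whose iteration leaves a remainder of order
  \<open>(C / cmod z) ^ n\<close>.
\<close>
lemma resolvent_integral_sums:
  assumes \<gamma>: "prob_space \<gamma>" and A: "L2_bounded_operator \<gamma> A"
    and C: "1 \<le> C" "\<And>f. f \<in> L2_space \<gamma> \<Longrightarrow> L2_norm \<gamma> (A f) \<le> C * L2_norm \<gamma> f"
    and R: "resolvent_at \<gamma> A z R" and z: "C < cmod z" and f: "f \<in> L2_space \<gamma>"
  shows "(\<lambda>n. (LINT x|\<gamma>. (A ^^ n) f x) * (1 / z) ^ n) sums (z * (LINT x|\<gamma>. R f x))"
proof -
  define m where "m n = (LINT x|\<gamma>. (A ^^ n) f x)" for n
  define \<psi> where "\<psi> n = (LINT x|\<gamma>. R ((A ^^ n) f) x)" for n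
  note bR = resolvent_atD(1)[OF R] and it = iterate_L2[OF A f]
  have z0: "z \<noteq> 0" using z C(1) by auto
  have L2R: "R ((A ^^ n) f) \<in> L2_space \<gamma>" for n
    by (rule L2_bounded_operatorD(1)[OF bR it])
  have step: "z * \<psi> n = m n + \<psi> (Suc n)" for n
  proof -
    have "AE x in \<gamma>. R (\<lambda>y. z * (A ^^ n) f y - (A ^^ Suc n) f y) x = (A ^^ n) f x"
      using resolvent_atD(2)[OF R it] by simp
    moreover have "AE x in \<gamma>. R (\<lambda>y. z * (A ^^ n) f y - (A ^^ Suc n) f y) x
        = R (\<lambda>y. z * (A ^^ n) f y) x - R ((A ^^ Suc n) f) x"
      by (rule L2_bounded_operator_diff[OF bR L2_space_cmult[OF it] it])
    moreover have "AE x in \<gamma>. R (\<lambda>y. z * (A ^^ n) f y) x = z * R ((A ^^ n) f) x"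
      by (rule L2_bounded_operatorD(3)[OF bR it])
    ultimately have ae: "AE x in \<gamma>. z * R ((A ^^ n) f) x = (A ^^ n) f x + R ((A ^^ Suc n) f) x"
      by eventually_elim simp
    have "z * \<psi> n = (LINT x|\<gamma>. z * R ((A ^^ n) f) x)"
      by (simp add: \<psi>_def)
    also have "\<dots> = (LINT x|\<gamma>. (A ^^ n) f x + R ((A ^^ Suc n) f) x)"
      using ae L2_spaceD(1)[OF L2R[of n]] L2_spaceD(1)[OF L2R[of "Suc n"]] L2_spaceD(1)[OF it[of n]]
      by (intro integral_cong_AE) auto
    also have "\<dots> = m n + \<psi> (Suc n)"
      unfolding m_def \<psi>_def
      by (rule Bochner_Integration.integral_add[OF L2_integral_bound(1)[OF \<gamma> it] L2_integral_bound(1)[OF \<gamma> L2R]])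
    finally show ?thesis .
  qed
  have partial: "(\<Sum>k<n. m k * (1 / z) ^ k) = z * \<psi> 0 - z * \<psi> n * (1 / z) ^ n" for n
  proof (induction n)
    case (Suc n)
    have "z * \<psi> (Suc n) * (1 / z) ^ Suc n = \<psi> (Suc n) * (1 / z) ^ n"
      using z0 by simp
    with Suc step[of n] show ?case by (simp add: algebra_simps)
  qed simp
  obtain CR where CR: "1 \<le> CR" "\<And>f. f \<in> L2_space \<gamma> \<Longrightarrow> L2_norm \<gamma> (R f) \<le> CR * L2_norm \<gamma> f"
    using L2_bounded_operator_bound[OF bR] by blast
  have psi_le: "cmod (\<psi> n) \<le> CR * (C ^ n * L2_norm \<gamma> f)" for n
  proof -
    have "cmod (\<psi> n) \<le> L2_norm \<gamma> (R ((A ^^ n) f))"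
      unfolding \<psi>_def by (rule L2_integral_bound(2)[OF \<gamma> L2R])
    also have "\<dots> \<le> CR * L2_norm \<gamma> ((A ^^ n) f)" by (rule CR(2)[OF it])
    also have "\<dots> \<le> CR * (C ^ n * L2_norm \<gamma> f)"
      using CR(1) by (intro mult_left_mono iterate_L2_norm_le[OF A C f]) auto
    finally show ?thesis .
  qed
  have "(\<lambda>n. z * \<psi> n * (1 / z) ^ n) \<longlonglongrightarrow> 0"
  proof (rule Lim_null_comparison)
    show "eventually (\<lambda>n. norm (z * \<psi> n * (1 / z) ^ n) \<le> cmod z * CR * L2_norm \<gamma> f * (C / cmod z) ^ n) sequentially"
    proof (intro always_eventually allI)
      fix n
      have "norm (z * \<psi> n * (1 / z) ^ n) = cmod z * cmod (\<psi> n) / cmod z ^ n"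
        by (simp add: norm_mult norm_power norm_divide power_divide)
      also have "\<dots> \<le> cmod z * (CR * (C ^ n * L2_norm \<gamma> f)) / cmod z ^ n"
        by (intro divide_right_mono mult_left_mono psi_le) auto
      finally show "norm (z * \<psi> n * (1 / z) ^ n) \<le> cmod z * CR * L2_norm \<gamma> f * (C / cmod z) ^ n"
        by (simp add: power_divide mult_ac)
    qed
    have "norm (C / cmod z) < 1" using z C(1) by (simp add: norm_divide divide_less_eq)
    then show "(\<lambda>n. cmod z * CR * L2_norm \<gamma> f * (C / cmod z) ^ n) \<longlonglongrightarrow> 0"
      by (intro tendsto_mult_right_zero LIMSEQ_power_zero)
  qed
  then have "(\<lambda>n. z * \<psi> 0 - z * \<psi> n * (1 / z) ^ n) \<longlonglongrightarrow> z * \<psi> 0 - 0"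
    by (intro tendsto_diff tendsto_const)
  then show ?thesis
    unfolding sums_def partial[symmetric] by (simp add: m_def \<psi>_def)
qed

text \<open>
  A scalar form of the spectral radius formula.  Put \<open>\<psi> z\<close> for the integral of \<open>R z f\<close>; it is
  holomorphic for \<open>r < cmod z\<close>.  In the variable \<open>w = 1 / z\<close> the function \<open>\<psi> (1 / w) / w\<close> is therefore
  holomorphic on the punctured disc of radius \<open>1 / r\<close>, and the Neumann series, valid for small \<open>w\<close>,
  removes the singularity at \<open>0\<close> and identifies the Taylor coefficients as the integrals of the
  iterates.  The Taylor series converges on the whole disc of holomorphy.
\<close>
theorem iterate_integrals_conv_radius:
  assumes \<gamma>: "prob_space \<gamma>" and A: "L2_bounded_operator \<gamma> A" and f: "f \<in> L2_space \<gamma>"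
    and r: "0 < r" and radius: "L2_spectral_radius \<gamma> A < ennreal r"
  shows "ereal (1 / r) \<le> conv_radius (\<lambda>n. LINT x|\<gamma>. (A ^^ n) f x)"
proof -
  define m where "m n = (LINT x|\<gamma>. (A ^^ n) f x)" for n
  define U where "U = {z :: complex. r < cmod z}"
  have U: "open U" unfolding U_def by (intro open_Collect_less continuous_intros)
  have "\<exists>R. resolvent_at \<gamma> A z R" if "z \<in> U" for z
  proof (rule ccontr)
    assume "\<not> (\<exists>R. resolvent_at \<gamma> A z R)"
    then have "ennreal (cmod z) \<le> L2_spectral_radius \<gamma> A"
      unfolding L2_spectral_radius_def L2_spectrum_def
      by (intro SUP_upper) (simp add: L2_resolvent_set_iff)
    with radius have "ennreal (cmod z) < ennreal r" by (rule le_less_trans[rotated])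
    with that r show False by (simp add: U_def ennreal_less_iff)
  qed
  then obtain R where R: "\<And>z. z \<in> U \<Longrightarrow> resolvent_at \<gamma> A z (R z)"
    by metis
  define \<psi> where "\<psi> z = (LINT x|\<gamma>. R z f x)" for z
  have psi_holo: "\<psi> holomorphic_on U"
    using resolvent_integral_has_derivative[OF \<gamma> A U _ R f]
    unfolding \<psi>_def holomorphic_on_open[OF U] by blast
  obtain C0 where C0: "1 \<le> C0" "\<And>f. f \<in> L2_space \<gamma> \<Longrightarrow> L2_norm \<gamma> (A f) \<le> C0 * L2_norm \<gamma> f"
    using L2_bounded_operator_bound[OF A] by blast
  \<comment> \<open>The maximum with \<open>r\<close> puts the disc of the Neumann series inside the disc of radius \<open>1 / r\<close>.\<close>
  define C where "C = max C0 r"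
  have C: "1 \<le> C" "r \<le> C" using C0(1) by (auto simp: C_def)
  have C_bound: "L2_norm \<gamma> (A f) \<le> C * L2_norm \<gamma> f" if "f \<in> L2_space \<gamma>" for f
    using C0(2)[OF that] mult_right_mono[of C0 C "L2_norm \<gamma> f"] L2_norm_nonneg[of \<gamma> f]
    by (simp add: C_def)
  define F where "F w = (if w = 0 then m 0 else \<psi> (1 / w) / w)" for w
  have F_sums: "(\<lambda>n. m n * w ^ n) sums F w" if w: "w \<in> ball 0 (1 / C)" for w
  proof (cases "w = 0")
    case True
    then show ?thesis using powser_sums_zero[of m] by (simp add: F_def)
  next
    case False
    have "cmod w < 1 / C" using w by simp
    then have big: "C < cmod (1 / w)"
      using False C by (simp add: norm_divide field_simps)
    then have "1 / w \<in> U" using C by (simp add: U_def)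
    from resolvent_integral_sums[OF \<gamma> A C(1) C_bound R[OF this] big f]
    show ?thesis using False by (simp add: F_def m_def \<psi>_def)
  qed
  have F_near: "F holomorphic_on ball 0 (1 / C)"
    using F_sums by (intro power_series_holomorphic[where a = m]) simp
  have F_away: "F holomorphic_on ball 0 (1 / r) - {0}"
  proof -
    have "(\<lambda>w. \<psi> (1 / w) / w) holomorphic_on ball 0 (1 / r) - {0}"
    proof (intro holomorphic_on_divide holomorphic_on_ident)
      have "(\<psi> \<circ> (\<lambda>w. 1 / w)) holomorphic_on ball 0 (1 / r) - {0}"
      proof (rule holomorphic_on_compose_gen[OF _ psi_holo])
        show "(\<lambda>w. 1 / w) holomorphic_on ball 0 (1 / r) - {0}"
          by (intro holomorphic_intros) auto
        show "(\<lambda>w. 1 / w) ` (ball 0 (1 / r) - {0}) \<subseteq> U"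
          using r by (auto simp: U_def norm_divide field_simps)
      qed
      then show "(\<lambda>w. \<psi> (1 / w)) holomorphic_on ball 0 (1 / r) - {0}"
        by (simp add: o_def)
    qed auto
    then show ?thesis
      by (rule holomorphic_transform) (auto simp: F_def)
  qed
  have "F holomorphic_on (ball 0 (1 / C) \<union> (ball 0 (1 / r) - {0}))"
    by (intro holomorphic_on_Un F_near F_away open_ball open_delete)
  then have "F holomorphic_on ball 0 (1 / r)"
    by (rule holomorphic_on_subset) (use C in auto)
  then have holo: "F holomorphic_on eball 0 (ereal (1 / r))"
    by simp
  have "F has_fps_expansion Abs_fps m"
  proof -
    have "eventually (\<lambda>w. w \<in> ball 0 (1 / C)) (nhds (0 :: complex))"
      using C by (intro eventually_nhds_in_open) auto
    then have "eventually (\<lambda>w. eval_fps (Abs_fps m) w = F w) (nhds 0)"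
      by eventually_elim (use F_sums in \<open>auto simp: eval_fps_def sums_iff\<close>)
    moreover have "0 < fps_conv_radius (Abs_fps m)"
    proof -
      have "0 < ereal (norm (complex_of_real (1 / (2 * C))))" using C by simp
      also have "\<dots> \<le> conv_radius m"
        using F_sums[of "complex_of_real (1 / (2 * C))"] C
        by (intro conv_radius_geI) (auto simp: sums_iff norm_divide field_simps)
      finally show ?thesis
        by (simp add: fps_conv_radius_def)
    qed
    ultimately show ?thesis by (simp add: has_fps_expansion_def)
  qed
  moreover have "F has_fps_expansion fps_expansion F 0"
    using r by (intro has_fps_expansion_fps_expansion[OF _ _ \<open>F holomorphic_on ball 0 (1 / r)\<close>]) auto
  ultimately have "fps_expansion F 0 = Abs_fps m"
    by (rule fps_expansion_unique_complex[symmetric])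
  then show ?thesis
    using conv_radius_fps_expansion[OF holo] by (simp add: fps_conv_radius_def m_def)
qed

section \<open>The cascade operator\<close>

locale damped_kernel_invariant = damped_kernel S lam p a
  for S \<gamma> :: "'s measure" and lam :: "'s \<Rightarrow> real" and p :: "'s \<Rightarrow> 's measure" and a :: real +
  assumes invariant: "invariant_prob S \<gamma> p"
begin

lemma prob_space_gamma: "prob_space \<gamma>"
  using invariant by (simp add: invariant_prob_def)

lemma sets_gamma [measurable_cong]: "sets \<gamma> = sets S"
  using invariant by (simp add: invariant_prob_def)

lemma space_gamma: "space \<gamma> = space S"
  by (rule sets_eq_imp_space_eq[OF sets_gamma])

abbreviation cascade_op :: "('s \<Rightarrow> complex) \<Rightarrow> 's \<Rightarrow> complex" where
  "cascade_op \<equiv> cascade_operator lam p a"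

lemma nn_integral_kernel_invariant:
  assumes [measurable]: "H \<in> borel_measurable S"
  shows "(\<integral>\<^sup>+x. \<integral>\<^sup>+y. H y \<partial>p x \<partial>\<gamma>) = (\<integral>\<^sup>+y. H y \<partial>\<gamma>)"
proof -
  have "(\<integral>\<^sup>+y. H y \<partial>(\<gamma> \<bind> p)) = (\<integral>\<^sup>+x. \<integral>\<^sup>+y. H y \<partial>p x \<partial>\<gamma>)"
    by (rule nn_integral_bind[where B = S]) measurable
  then show ?thesis
    using invariant by (simp add: invariant_prob_def)
qed

lemma L2_measurable:
  assumes "f \<in> L2_space \<gamma>"
  shows "f \<in> borel_measurable S"
  using L2_spaceD(1)[OF assms] by (simp add: measurable_cong_sets[OF sets_gamma refl])

text \<open>
  The integral defining the cascade operator takes its default value \<open>0\<close> where \<open>f\<close> is not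
  \<open>p x\<close>-integrable.  Invariance of \<open>\<gamma>\<close> makes this exceptional set of \<open>x\<close> negligible, which is what
  gives additivity almost everywhere.
\<close>
lemma AE_L2_kernel:
  assumes f: "f \<in> L2_space \<gamma>"
  shows "AE x in \<gamma>. x \<in> space S \<and> f \<in> L2_space (p x)"
proof -
  note [measurable] = L2_measurable[OF f]
  have "(\<integral>\<^sup>+x. \<integral>\<^sup>+y. ennreal ((cmod (f y))\<^sup>2) \<partial>p x \<partial>\<gamma>) = (\<integral>\<^sup>+y. ennreal ((cmod (f y))\<^sup>2) \<partial>\<gamma>)"
    by (rule nn_integral_kernel_invariant) measurable
  also have "\<dots> \<noteq> \<infinity>"
    using L2_spaceD(2)[OF f] by (simp add: integrable_iff_bounded less_top)
  finally have "AE x in \<gamma>. (\<integral>\<^sup>+y. ennreal ((cmod (f y))\<^sup>2) \<partial>p x) \<noteq> \<infinity>"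
    by (intro nn_integral_noteq_infinite) measurable
  then show ?thesis
    using AE_space
  proof eventually_elim
    case (elim x)
    then have x: "x \<in> space S" by (simp add: space_gamma)
    have [measurable_cong]: "sets (p x) = sets S" by (rule markov_kernelD(2)[OF kernel x])
    show ?case
      using elim x by (auto simp: L2_space_def integrable_iff_bounded less_top)
  qed
qed

lemma cascade_operator_square_le:
  assumes x: "x \<in> space S" and f: "f \<in> L2_space (p x)"
  shows "ennreal ((cmod (cascade_op f x))\<^sup>2) \<le> (\<integral>\<^sup>+y. ennreal ((cmod (f y))\<^sup>2) \<partial>p x)"
proof -
  have "cmod (cascade_op f x) = damping x * cmod (LINT y|p x. f y)"
    using damping_bounds[OF x] unfolding cascade_operator_def norm_mult norm_of_real by (simp only: abs_of_pos)
  also have "\<dots> \<le> 1 * L2_norm (p x) f"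
    using damping_bounds[OF x]
    by (intro mult_mono L2_integral_bound(2)[OF markov_kernelD(1)[OF kernel x] f]) auto
  finally have "(cmod (cascade_op f x))\<^sup>2 \<le> (L2_norm (p x) f)\<^sup>2"
    by (intro power_mono) auto
  then have "ennreal ((cmod (cascade_op f x))\<^sup>2) \<le> ennreal (LINT y|p x. (cmod (f y))\<^sup>2)"
    unfolding L2_norm_square by (rule ennreal_leI)
  also have "\<dots> = (\<integral>\<^sup>+y. ennreal ((cmod (f y))\<^sup>2) \<partial>p x)"
    by (rule nn_integral_eq_integral[OF L2_spaceD(2)[OF f], symmetric]) simp
  finally show ?thesis .
qed

text \<open>
  Averaging with \<open>p x\<close> decreases the mean square, and the mean over \<open>\<gamma>\<close> undoes the averaging by
  invariance.
\<close>
lemma cascade_operator_contraction: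
  assumes f: "f \<in> L2_space \<gamma>"
  shows "cascade_op f \<in> L2_space \<gamma>" and "L2_norm \<gamma> (cascade_op f) \<le> L2_norm \<gamma> f"
proof -
  note [measurable] = L2_measurable[OF f]
  have "(\<lambda>x. LINT y|p x. f y) \<in> borel_measurable S"
    by (rule measurable_compose[OF kernel_subprob integral_measurable_subprob_algebra]) measurable
  then have [measurable]: "cascade_op f \<in> borel_measurable \<gamma>"
    unfolding cascade_operator_def measurable_cong_sets[OF sets_gamma refl] by measurable
  have "(\<integral>\<^sup>+x. ennreal ((cmod (cascade_op f x))\<^sup>2) \<partial>\<gamma>) \<le> (\<integral>\<^sup>+x. \<integral>\<^sup>+y. ennreal ((cmod (f y))\<^sup>2) \<partial>p x \<partial>\<gamma>)"
  proof (rule nn_integral_mono_AE)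
    show "AE x in \<gamma>. ennreal ((cmod (cascade_op f x))\<^sup>2) \<le> (\<integral>\<^sup>+y. ennreal ((cmod (f y))\<^sup>2) \<partial>p x)"
      using AE_L2_kernel[OF f] by eventually_elim (blast intro: cascade_operator_square_le)
  qed
  also have "\<dots> = (\<integral>\<^sup>+y. ennreal ((cmod (f y))\<^sup>2) \<partial>\<gamma>)"
    by (rule nn_integral_kernel_invariant) measurable
  also have "\<dots> = ennreal (LINT y|\<gamma>. (cmod (f y))\<^sup>2)"
    by (rule nn_integral_eq_integral[OF L2_spaceD(2)[OF f]]) simp
  finally have le: "(\<integral>\<^sup>+x. ennreal ((cmod (cascade_op f x))\<^sup>2) \<partial>\<gamma>) \<le> ennreal (LINT y|\<gamma>. (cmod (f y))\<^sup>2)" .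
  then have int: "integrable \<gamma> (\<lambda>x. (cmod (cascade_op f x))\<^sup>2)"
    by (auto simp: integrable_iff_bounded intro: le_less_trans)
  then show "cascade_op f \<in> L2_space \<gamma>" by (simp add: L2_space_def)
  have "ennreal (LINT x|\<gamma>. (cmod (cascade_op f x))\<^sup>2) \<le> ennreal (LINT y|\<gamma>. (cmod (f y))\<^sup>2)"
    using le by (subst nn_integral_eq_integral[OF int, symmetric]) auto
  then show "L2_norm \<gamma> (cascade_op f) \<le> L2_norm \<gamma> f"
    by (simp add: L2_norm_def ennreal_le_iff)
qed

lemma cascade_operator_bounded: "L2_bounded_operator \<gamma> cascade_op"
  unfolding L2_bounded_operator_def
proof (intro conjI ballI allI)
  fix f u assume f: "f \<in> L2_space \<gamma>" and u: "u \<in> L2_space \<gamma>"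
  show "AE x in \<gamma>. cascade_op (\<lambda>y. f y + u y) x = cascade_op f x + cascade_op u x"
    using AE_L2_kernel[OF f] AE_L2_kernel[OF u]
  proof eventually_elim
    case (elim x)
    note P = markov_kernelD(1)[OF kernel conjunct1[OF elim(1)]]
    show ?case
      unfolding cascade_operator_def
      by (subst Bochner_Integration.integral_add)
         (use L2_integral_bound(1)[OF P] elim in \<open>auto simp: distrib_left\<close>)
  qed
next
  fix c f
  show "AE x in \<gamma>. cascade_op (\<lambda>y. c * f y) x = c * cascade_op f x"
    by (simp add: cascade_operator_def)
next
  show "\<exists>C. \<forall>f\<in>L2_space \<gamma>. L2_norm \<gamma> (cascade_op f) \<le> C * L2_norm \<gamma> f"
    using cascade_operator_contraction(2) by (intro exI[of _ 1]) simp
qed (rule cascade_operator_contraction(1))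

abbreviation cmass :: "nat \<Rightarrow> 's \<Rightarrow> complex" where
  "cmass n \<equiv> \<lambda>x. complex_of_real (mass n x)"

lemma cascade_operator_damped_mass: "cascade_op (cmass n) = cmass (Suc n)"
  by (rule ext) (simp only: cascade_operator_def integral_complex_of_real damped_mass.simps of_real_mult)

lemma cascade_operator_iterate: "(cascade_op ^^ n) (\<lambda>_. 1) = cmass n"
proof (induction n)
  case (Suc n)
  show ?case
    unfolding funpow.simps o_apply Suc by (rule cascade_operator_damped_mass)
qed simp

lemma cmass_L2: "cmass n \<in> L2_space \<gamma>"
proof -
  interpret prob_space \<gamma> by (rule prob_space_gamma)
  have [measurable]: "cmass n \<in> borel_measurable \<gamma>"
    by measurable
  have "integrable \<gamma> (\<lambda>x. (cmod (cmass n x))\<^sup>2)"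
  proof (rule integrable_const_bound[where B = 1, OF AE_I2])
    fix x assume "x \<in> space \<gamma>"
    then have "\<bar>mass n x\<bar> \<le> 1" using damped_mass_bounds[of x n] by (simp add: space_gamma)
    then show "norm ((cmod (cmass n x))\<^sup>2) \<le> 1" by (simp add: abs_square_le_1)
  qed measurable
  then show ?thesis by (simp add: L2_space_def)
qed

text \<open>
  The operator norm is a supremum over the unit ball.  Scaling by slightly more than the norm of the
  argument avoids a division by zero.
\<close>
lemma operator_norm_bound:
  assumes q: "0 \<le> q" "L2_operator_norm \<gamma> cascade_op \<le> ennreal q"
  shows "L2_norm \<gamma> (cmass (Suc n)) \<le> q * L2_norm \<gamma> (cmass n)"
proof (rule field_le_epsilon)
  fix d :: real assume d: "0 < d"
  define s where "s = L2_norm \<gamma> (cmass n) + d / (q + 1)"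
  have s: "0 < s" "L2_norm \<gamma> (cmass n) \<le> s"
    using d q L2_norm_nonneg[of \<gamma> "cmass n"] by (auto simp: s_def add_nonneg_pos)
  define f where "f = (\<lambda>x. complex_of_real (1 / s) * cmass n x)"
  have f: "f \<in> L2_space \<gamma>" unfolding f_def by (rule L2_space_cmult[OF cmass_L2])
  have "L2_norm \<gamma> f \<le> 1"
    unfolding f_def L2_norm_cmult using s by (simp add: norm_divide)
  then have "ennreal (L2_norm \<gamma> (cascade_op f)) \<le> L2_operator_norm \<gamma> cascade_op"
    unfolding L2_operator_norm_def using f by (intro SUP_upper) simp
  then have "L2_norm \<gamma> (cascade_op f) \<le> q"
    using q by (metis ennreal_le_iff order_trans)
  moreover have "cascade_op f = (\<lambda>x. complex_of_real (1 / s) * cascade_op (cmass n) x)"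
    unfolding f_def cascade_operator_def
    by (rule ext) (simp only: integral_mult_right_zero mult.left_commute[of _ "complex_of_real (1 / s)"])
  then have "cascade_op f = (\<lambda>x. complex_of_real (1 / s) * cmass (Suc n) x)"
    unfolding cascade_operator_damped_mass .
  then have "L2_norm \<gamma> (cascade_op f) = L2_norm \<gamma> (cmass (Suc n)) / s"
    using s(1) by (simp only: L2_norm_cmult) (simp add: norm_divide del: damped_mass.simps)
  ultimately have "L2_norm \<gamma> (cmass (Suc n)) \<le> q * s"
    using s(1) by (simp add: divide_le_eq del: damped_mass.simps)
  also have "\<dots> \<le> q * L2_norm \<gamma> (cmass n) + d"
  proof -
    have "q * (d / (q + 1)) \<le> d" using d q by (simp add: divide_le_eq field_simps)
    then show ?thesis by (simp add: s_def distrib_left)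
  qed
  finally show "L2_norm \<gamma> (cmass (Suc n)) \<le> q * L2_norm \<gamma> (cmass n) + d" .
qed

lemma summable_if_operator_norm:
  assumes "L2_operator_norm \<gamma> cascade_op < 1 / 2"
  shows "summable (\<lambda>n. 2 ^ n * (LINT x|\<gamma>. mass n x))"
proof -
  obtain q where q: "0 \<le> q" "L2_operator_norm \<gamma> cascade_op = ennreal q" "q < 1 / 2"
  proof (cases "L2_operator_norm \<gamma> cascade_op")
    case (real q)
    then have "ennreal q < ennreal (1 / 2)" using assms by (simp add: divide_ennreal_def)
    then have "q < 1 / 2" using real(1) by (simp only: ennreal_less_iff)
    then show thesis using that real by blast
  qed (use assms in simp)
  have norm: "L2_norm \<gamma> (cmass n) \<le> q ^ n" for n
  proof (induction n)
    case 0
    then show ?case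
      using prob_space.prob_space[OF prob_space_gamma] by (simp add: L2_norm_def)
  next
    case (Suc n)
    have "L2_norm \<gamma> (cmass (Suc n)) \<le> q * L2_norm \<gamma> (cmass n)"
      by (rule operator_norm_bound) (use q in auto)
    also have "\<dots> \<le> q * q ^ n" using q by (intro mult_left_mono Suc) auto
    finally show ?case by simp
  qed
  show ?thesis
  proof (rule summable_comparison_test[OF _ summable_geometric[of "2 * q"]])
    have "norm (2 ^ n * (LINT x|\<gamma>. mass n x)) \<le> (2 * q) ^ n" for n
    proof -
      have "\<bar>LINT x|\<gamma>. mass n x\<bar> \<le> L2_norm \<gamma> (cmass n)"
        using L2_integral_bound(2)[OF prob_space_gamma cmass_L2[of n]] by simp
      also have "\<dots> \<le> q ^ n" by (rule norm)
      finally show ?thesis by (simp add: abs_mult power_mult_distrib)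
    qed
    then show "\<exists>N. \<forall>n\<ge>N. norm (2 ^ n * (LINT x|\<gamma>. mass n x)) \<le> (2 * q) ^ n" by blast
  qed (use q in auto)
qed

text \<open>
  The integrals of the iterates form a power series with radius of convergence larger than \<open>2\<close>, so it
  can be evaluated at \<open>2\<close>, the branching number of the tree.
\<close>
lemma summable_if_spectral_radius:
  assumes "L2_spectral_radius \<gamma> cascade_op < 1 / 2"
  shows "summable (\<lambda>n. 2 ^ n * (LINT x|\<gamma>. mass n x))"
proof -
  obtain t where t: "L2_spectral_radius \<gamma> cascade_op < t" "t < 1 / 2"
    using dense[OF assms] by blast
  obtain r where r: "t = ennreal r" "0 \<le> r" using t(2) by (cases t) auto
  have "0 < t" using t(1) by (rule le_less_trans[rotated]) simp
  with r have r0: "0 < r" by simp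
  have "ennreal r < ennreal (1 / 2)" using t(2) r by (simp add: divide_ennreal_def)
  then have r2: "r < 1 / 2" using r(2) by (simp only: ennreal_less_iff)
  have "(\<lambda>_. 1) \<in> L2_space \<gamma>" using cmass_L2[of 0] by simp
  from iterate_integrals_conv_radius[OF prob_space_gamma cascade_operator_bounded this r0] t(1) r
  have "ereal (1 / r) \<le> conv_radius (\<lambda>n. LINT x|\<gamma>. cmass n x)"
    by (simp add: cascade_operator_iterate)
  moreover have "ereal (norm (2 :: complex)) < ereal (1 / r)"
    using r0 r2 by (simp add: field_simps)
  ultimately have "summable (\<lambda>n. (LINT x|\<gamma>. cmass n x) * 2 ^ n)"
    by (intro summable_in_conv_radius) (rule less_le_trans)
  then have "summable (\<lambda>n. complex_of_real (2 ^ n * (LINT x|\<gamma>. mass n x)))"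
    by (simp add: mult.commute)
  then show ?thesis
    by (simp only: summable_complex_of_real)
qed

lemma AE_total_mass_finite:
  assumes "summable (\<lambda>n. 2 ^ n * (LINT x|\<gamma>. mass n x))"
  shows "AE x in \<gamma>. total_mass x < \<infinity>"
proof -
  interpret prob_space \<gamma> by (rule prob_space_gamma)
  have nn: "0 \<le> 2 ^ n * (LINT x|\<gamma>. mass n x)" for n
    using damped_mass_bounds by (intro mult_nonneg_nonneg integral_nonneg_AE AE_I2) (auto simp: space_gamma)
  have "(\<integral>\<^sup>+x. total_mass x \<partial>\<gamma>) = (\<Sum>n. \<integral>\<^sup>+x. ennreal (2 ^ n * mass n x) \<partial>\<gamma>)"
    unfolding total_mass_def by (rule nn_integral_suminf) measurable
  also have "\<dots> = (\<Sum>n. ennreal (2 ^ n * (LINT x|\<gamma>. mass n x)))"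
  proof (intro suminf_cong)
    fix n
    have "(\<integral>\<^sup>+x. ennreal (2 ^ n * mass n x) \<partial>\<gamma>) = ennreal (LINT x|\<gamma>. 2 ^ n * mass n x)"
      using damped_mass_bounds
      by (intro nn_integral_eq_integral integrable_mult_right integrable_damped_mass AE_I2)
         (auto simp: space_gamma sets_gamma finite_measure_axioms)
    then show "(\<integral>\<^sup>+x. ennreal (2 ^ n * mass n x) \<partial>\<gamma>) = ennreal (2 ^ n * (LINT x|\<gamma>. mass n x))" by simp
  qed
  also have "\<dots> \<noteq> \<infinity>"
    using suminf_ennreal2[OF nn assms] by simp
  finally have "AE x in \<gamma>. total_mass x \<noteq> \<infinity>"
    by (intro nn_integral_noteq_infinite) measurable
  then show ?thesis by (simp add: less_top)
qed

end

section \<open>Non-explosion\<close>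

lemma (in dsy_cascade_type_M) law_root:
  assumes "AE \<omega> in M. X [] \<omega> = x" and "x \<in> space S"
  shows "distr M S (X []) = return S x"
proof -
  have "distr M S (X []) = distr M S (\<lambda>_. x)"
    using assms by (intro distr_cong_AE) auto
  also have "\<dots> = return S x"
    by (rule distr_const) fact
  finally show ?thesis .
qed

lemma (in dsy_cascade_type_M) law_child:
  assumes root: "AE \<omega> in M. X [] \<omega> = x" and x: "x \<in> space S"
  shows "distr M S (X [b]) = p x"
proof (rule measure_eqI)
  show "sets (distr M S (X [b])) = sets (p x)"
    by (simp add: markov_kernelD(2)[OF kernel x])
  fix B assume "B \<in> sets (distr M S (X [b]))"
  then have B [measurable]: "B \<in> sets S" by simp
  define s where "s = (\<lambda>_ :: nat. b)"
  have s: "path_vertex s 0 = []" "path_vertex s (Suc 0) = [b]"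
    by (simp_all add: path_vertex_def s_def)
  note [measurable] = markov_kernel_subprob[OF kernel]
  have "emeasure (distr M S (X [b])) B = (\<integral>\<^sup>+y. indicator B y \<partial>distr M S (X [b]))"
    by simp
  also have "\<dots> = (\<integral>\<^sup>+\<omega>. ennreal 1 * indicator B (X (path_vertex s (Suc 0)) \<omega>) \<partial>M)"
    by (subst nn_integral_distr) (auto simp: s)
  also have "\<dots> = (\<integral>\<^sup>+\<omega>. ennreal 1 * (\<integral>\<^sup>+y. indicator B y \<partial>p (X (path_vertex s 0) \<omega>)) \<partial>M)"
    by (rule markov_property_nn_integral[OF prob_space_axioms kernel markov_along_paths]) auto
  also have "\<dots> = (\<integral>\<^sup>+\<omega>. emeasure (p x) B \<partial>M)"
  proof (rule nn_integral_cong_AE)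
    have "(\<integral>\<^sup>+y. indicator B y \<partial>p x) = emeasure (p x) B"
      by (simp add: markov_kernelD(2)[OF kernel x])
    then show "AE \<omega> in M. ennreal 1 * (\<integral>\<^sup>+y. indicator B y \<partial>p (X (path_vertex s 0) \<omega>)) = emeasure (p x) B"
      using root by (auto elim!: eventually_mono simp: s)
  qed
  also have "\<dots> = emeasure (p x) B"
    by (simp add: emeasure_space_1)
  finally show "emeasure (distr M S (X [b])) B = emeasure (p x) B" .
qed

theorem corollary3p5:
  fixes S \<gamma> :: "'s measure"
    and lam :: "'s \<Rightarrow> real"
    and p :: "'s \<Rightarrow> 's measure"
  assumes lam_measurable: "lam \<in> borel_measurable S"
    and lam_positive: "\<And>x. x \<in> space S \<Longrightarrow> lam x > 0"
    and kernel: "markov_kernel S p"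
    and invariant: "invariant_prob S \<gamma> p"
    and reversible: "time_reversible S \<gamma> p"
    and small: "\<exists>a>0. L2_spectral_radius \<gamma> (cascade_operator lam p a) < 1/2 \<or>
                      L2_operator_norm \<gamma> (cascade_operator lam p a) < 1/2"
  shows "(AE x in \<gamma>. \<forall>(M :: 'w measure) T X.
            dsy_cascade_type_M M S lam p T X \<and> (AE \<omega> in M. X [] \<omega> = x)
              \<longrightarrow> non_explosive M T (\<lambda>v \<omega>. lam (X v \<omega>)))
       \<and> (\<forall>x\<^sub>0\<in>space S. absolutely_continuous \<gamma> (p x\<^sub>0) \<longrightarrow>
            (\<forall>(M :: 'w measure) T X.
              dsy_cascade_type_M M S lam p T X \<and> (AE \<omega> in M. X [] \<omega> = x\<^sub>0)
                \<longrightarrow> non_explosive M T (\<lambda>v \<omega>. lam (X v \<omega>))))"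
proof -
  obtain a where a: "0 < a"
    and small_a: "L2_spectral_radius \<gamma> (cascade_operator lam p a) < 1/2 \<or>
                  L2_operator_norm \<gamma> (cascade_operator lam p a) < 1/2"
    using small by blast
  interpret damped_kernel_invariant S \<gamma> lam p a
    by unfold_locales (fact lam_measurable lam_positive kernel a invariant)+
  have total_fin: "AE x in \<gamma>. total_mass x < \<infinity>"
    using small_a summable_if_spectral_radius summable_if_operator_norm by (blast intro: AE_total_mass_finite)
  \<comment> \<open>The level \<open>m\<close> is \<open>0\<close> for almost every initial state and \<open>1\<close> for a state with absolutely continuous transition law.\<close>
  have main: "non_explosive M T (\<lambda>v \<omega>. lam (X v \<omega>))"
    if "dsy_cascade_type_M M S lam p T X" and "\<And>u. length u = m \<Longrightarrow> distr M S (X u) = \<mu>"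
      and "AE y in \<mu>. total_mass y < \<infinity>"
    for M :: "'w measure" and T X m \<mu>
  proof -
    interpret dsy_cascade_type_M M S lam p T X by fact
    show ?thesis
      using that(2,3) unfolding total_mass_def
      by (intro non_explosive_if_level_weights_vanish[OF a] level_weights_vanish[OF a])
  qed
  have "AE x in \<gamma>. \<forall>(M :: 'w measure) T X.
            dsy_cascade_type_M M S lam p T X \<and> (AE \<omega> in M. X [] \<omega> = x)
              \<longrightarrow> non_explosive M T (\<lambda>v \<omega>. lam (X v \<omega>))"
    using total_fin AE_space
  proof eventually_elim
    case (elim x)
    then have x: "x \<in> space S" by (simp add: space_gamma)
    have fin: "AE y in return S x. total_mass y < \<infinity>"
      using elim x by (subst AE_return) auto
    show ?case
    proof (intro allI impI, elim conjE)
      fix M :: "'w measure" and T X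
      assume casc: "dsy_cascade_type_M M S lam p T X" and root: "AE \<omega> in M. X [] \<omega> = x"
      show "non_explosive M T (\<lambda>v \<omega>. lam (X v \<omega>))"
        by (rule main[where m = 0, OF casc _ fin])
           (simp add: dsy_cascade_type_M.law_root[OF casc root x])
    qed
  qed
  moreover have "non_explosive M T (\<lambda>v \<omega>. lam (X v \<omega>))"
    if x: "x \<in> space S" and ac: "absolutely_continuous \<gamma> (p x)"
      and casc: "dsy_cascade_type_M M S lam p T X" and root: "AE \<omega> in M. X [] \<omega> = x"
    for x and M :: "'w measure" and T X
  proof (rule main[OF casc])
    show "AE y in p x. total_mass y < \<infinity>"
      using absolutely_continuous_AE[OF _ ac total_fin]
      by (simp add: sets_gamma markov_kernelD(2)[OF kernel x])
    show "distr M S (X u) = p x" if "length u = 1" for u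
      using that dsy_cascade_type_M.law_child[OF casc root x] by (auto simp: length_Suc_conv)
  qed
  ultimately show ?thesis by blast
qed

end
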